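(* Let $(M,\varphi)$ be a connected locally conformal calibrated $G_2$-manifold with Lee form $\theta$. Let $X$ be the $g_\varphi$-dual vector field of $\theta$, i.e. $\theta(\cdot)=g_\varphi(X,\cdot)$, and define the 2-form $\omega:=i_X\varphi$. Then $\mathcal{L}_X\varphi=0$ if and only if $\theta(X)\varphi=d_\theta\omega$. Moreover, if $\mathcal{L}_X\varphi=0$, then $\theta(X)=|X|^2$ is a nonzero constant.
   Context: Notation: $e^{ij\cdots}=e^i\wedge e^j\wedge\cdots$; $\mathcal{L}$ is the Lie derivative and $i_X$ the contraction by $X$. A $G_2$-structure on a 7-manifold $M$ is a 3-form $\varphi$ which at each point can be written as $\varphi=e^{127}+e^{347}+e^{567}+e^{135}-e^{146}-e^{236}-e^{245}$ with respect to some local coframe $\{e^1,\ldots,e^7\}$. It induces a Riemannian metric $g_\varphi$ and a volume form $dV_{g_\varphi}$ by $g_\varphi(X,Y)\,dV_{g_\varphi}=\frac16 i_X\varphi\wedge i_Y\varphi\wedge\varphi$; $|X|$ is the norm with respect to $g_\varphi$. A locally conformal calibrated $G_2$-manifold with Lee form $\theta$ is a 7-manifold with a $G_2$-structure $\varphi$ such that $d\varphi=-\theta\wedge\varphi$ for a closed non-vanishing (i.e. nowhere zero) 1-form $\theta$. For a differential form $\alpha$, $d_\theta\alpha:=d\alpha+\theta\wedge\alpha$. *)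

theory Defs
  imports "HOL-Analysis.Analysis"
begin

section \<open>Exterior algebra of a real vector space\<close>

text \<open>
  A \<open>k\<close>-covector takes its arguments as a sequence \<open>v :: nat \<Rightarrow> 'v\<close> of which it
  only looks at the entries \<open>v 0, \<dots>, v (k - 1)\<close>.
\<close>

type_synonym 'v covec = "(nat \<Rightarrow> 'v) \<Rightarrow> real"

definition alternating_form :: "nat \<Rightarrow> 'v::real_vector covec \<Rightarrow> bool" where
  "alternating_form k a \<longleftrightarrow>
     (\<forall>v w. (\<forall>i<k. v i = w i) \<longrightarrow> a v = a w) \<and>
     (\<forall>v. \<forall>i<k. linear (\<lambda>u. a (v(i := u)))) \<and>
     (\<forall>v. \<forall>i<k. \<forall>j<k. i \<noteq> j \<and> v i = v j \<longrightarrow> a v = 0)"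

text \<open>Normalised so that \<open>(e\<^sup>1 \<and> e\<^sup>2)(e\<^sub>1, e\<^sub>2) = 1\<close> for dual bases.\<close>

definition wedge :: "nat \<Rightarrow> nat \<Rightarrow> 'v covec \<Rightarrow> 'v covec \<Rightarrow> 'v covec" where
  "wedge k l a b v =
     (\<Sum>\<sigma> | \<sigma> permutes {..<k + l}.
        of_int (sign \<sigma>) * a (\<lambda>i. v (\<sigma> i)) * b (\<lambda>i. v (\<sigma> (k + i)))) / (fact k * fact l)"

definition contract :: "'v \<Rightarrow> 'v covec \<Rightarrow> 'v covec" where
  "contract u a v = a (case_nat u v)"


section \<open>Linear algebra of \<open>G\<^sub>2\<close>-structures\<close>

definition coframe :: "(nat \<Rightarrow> (real^7) covec) \<Rightarrow> bool" where
  "coframe e \<longleftrightarrow>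
     (\<forall>i\<in>{1..7}. alternating_form 1 (e i)) \<and>
     (\<forall>c :: nat \<Rightarrow> real. (\<forall>v. (\<Sum>i=1..7. c i * e i v) = 0) \<longrightarrow> (\<forall>i\<in>{1..7}. c i = 0))"

definition e3 :: "(nat \<Rightarrow> 'v covec) \<Rightarrow> nat \<Rightarrow> nat \<Rightarrow> nat \<Rightarrow> 'v covec" where
  "e3 e i j k = wedge 1 2 (e i) (wedge 1 1 (e j) (e k))"

definition g2_form :: "(real^7) covec \<Rightarrow> bool" where
  "g2_form a \<longleftrightarrow> (\<exists>e. coframe e \<and>
     (\<forall>v. a v = e3 e 1 2 7 v + e3 e 3 4 7 v + e3 e 5 6 7 v + e3 e 1 3 5 v
              - e3 e 1 4 6 v - e3 e 2 3 6 v - e3 e 2 4 5 v))"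

definition inner_product :: "('v::real_vector \<Rightarrow> 'v \<Rightarrow> real) \<Rightarrow> bool" where
  "inner_product g \<longleftrightarrow>
     bilinear g \<and> (\<forall>x y. g x y = g y x) \<and> (\<forall>x. x \<noteq> 0 \<longrightarrow> g x x > 0)"

text \<open>A volume form of \<open>g\<close>, for one of the two orientations.\<close>

definition volume_form :: "(real^7 \<Rightarrow> real^7 \<Rightarrow> real) \<Rightarrow> (real^7) covec \<Rightarrow> bool" where
  "volume_form g dV \<longleftrightarrow> alternating_form 7 dV \<and>
     (\<forall>v. (\<forall>i<7. \<forall>j<7. g (v i) (v j) = (if i = j then 1 else 0)) \<longrightarrow> \<bar>dV v\<bar> = 1)"

text \<open>
  The inner product induced by a \<open>G\<^sub>2\<close>-form \<open>a\<close>: together with one of its own volume forms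
  (the identity fixes which one, hence the orientation) it satisfies
  \<open>g(x,y) dV = 1/6 i\<^sub>x a \<and> i\<^sub>y a \<and> a\<close>. This determines \<open>g\<close> uniquely.
\<close>

definition g2_metric :: "(real^7) covec \<Rightarrow> real^7 \<Rightarrow> real^7 \<Rightarrow> real" where
  "g2_metric a = (THE g. inner_product g \<and> (\<exists>dV. volume_form g dV \<and>
     (\<forall>x y v. g x y * dV v = 1/6 * wedge 2 5 (contract x a) (wedge 2 3 (contract y a) a) v)))"

definition g2_norm :: "(real^7) covec \<Rightarrow> real^7 \<Rightarrow> real" where
  "g2_norm a x = sqrt (g2_metric a x x)"


section \<open>Smooth 7-manifolds\<close>

primrec Ck_on :: "nat \<Rightarrow> 'v::real_normed_vector set \<Rightarrow> ('v \<Rightarrow> 'w::real_normed_vector) \<Rightarrow> bool" where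
  "Ck_on 0 S f \<longleftrightarrow> continuous_on S f"
| "Ck_on (Suc k) S f \<longleftrightarrow>
     (\<forall>x\<in>S. f differentiable (at x)) \<and> (\<forall>v. Ck_on k S (\<lambda>x. frechet_derivative f (at x) v))"

text \<open>Only used for open subsets of finite-dimensional spaces.\<close>

definition smooth_on :: "'v::real_normed_vector set \<Rightarrow> ('v \<Rightarrow> 'w::real_normed_vector) \<Rightarrow> bool" where
  "smooth_on S f \<longleftrightarrow> (\<forall>k. Ck_on k S f)"

text \<open>A chart is a pair of a domain \<open>U\<close> and a coordinate map, whose values off \<open>U\<close> are irrelevant.\<close>

type_synonym 'a chart = "'a set \<times> ('a \<Rightarrow> real^7)"

definition chart_image :: "'a chart \<Rightarrow> (real^7) set" where
  "chart_image C = snd C ` fst C"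

definition is_chart :: "'a topology \<Rightarrow> 'a chart \<Rightarrow> bool" where
  "is_chart M C \<longleftrightarrow> openin M (fst C) \<and> open (chart_image C) \<and>
     homeomorphic_map (subtopology M (fst C)) (top_of_set (chart_image C)) (snd C)"

definition transition :: "'a chart \<Rightarrow> 'a chart \<Rightarrow> real^7 \<Rightarrow> real^7" where
  "transition C C' = snd C' \<circ> inv_into (fst C) (snd C)"

definition smooth_atlas :: "'a topology \<Rightarrow> 'a chart set \<Rightarrow> bool" where
  "smooth_atlas M A \<longleftrightarrow>
     (\<forall>C\<in>A. is_chart M C) \<and> (\<Union>C\<in>A. fst C) = topspace M \<and>
     (\<forall>C\<in>A. \<forall>C'\<in>A. smooth_on (snd C ` (fst C \<inter> fst C')) (transition C C'))"

definition smooth_manifold :: "'a topology \<Rightarrow> 'a chart set \<Rightarrow> bool" where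
  "smooth_manifold M A \<longleftrightarrow>
     Hausdorff_space M \<and> second_countable M \<and> smooth_atlas M A"


section \<open>Tensor fields\<close>

text \<open>
  Vector fields and differential forms are given by their representatives in the charts of the
  atlas, \<open>\<alpha> C x\<close> being the value at the point with coordinates \<open>x\<close> in the chart \<open>C\<close>;
  the representatives have to be related by the transition maps on overlaps. Values for
  \<open>x \<notin> chart_image C\<close> are irrelevant.
\<close>

type_synonym 'a vfield = "'a chart \<Rightarrow> real^7 \<Rightarrow> real^7"
type_synonym 'a dform = "'a chart \<Rightarrow> real^7 \<Rightarrow> (real^7) covec"

definition vector_field :: "'a chart set \<Rightarrow> 'a vfield \<Rightarrow> bool" where
  "vector_field A X \<longleftrightarrow>
     (\<forall>C\<in>A. smooth_on (chart_image C) (X C)) \<and>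
     (\<forall>C\<in>A. \<forall>C'\<in>A. \<forall>p\<in>fst C \<inter> fst C'.
        X C' (snd C' p) = frechet_derivative (transition C C') (at (snd C p)) (X C (snd C p)))"

definition differential_form :: "'a chart set \<Rightarrow> nat \<Rightarrow> 'a dform \<Rightarrow> bool" where
  "differential_form A k \<alpha> \<longleftrightarrow>
     (\<forall>C\<in>A. \<forall>x\<in>chart_image C. alternating_form k (\<alpha> C x)) \<and>
     (\<forall>C\<in>A. \<forall>v. smooth_on (chart_image C) (\<lambda>x. \<alpha> C x v)) \<and>
     (\<forall>C\<in>A. \<forall>C'\<in>A. \<forall>p\<in>fst C \<inter> fst C'. \<forall>v.
        \<alpha> C (snd C p) v =
        \<alpha> C' (snd C' p) (\<lambda>i. frechet_derivative (transition C C') (at (snd C p)) (v i)))"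

definition form_eq :: "'a chart set \<Rightarrow> 'a dform \<Rightarrow> 'a dform \<Rightarrow> bool" where
  "form_eq A \<alpha> \<beta> \<longleftrightarrow> (\<forall>C\<in>A. \<forall>x\<in>chart_image C. \<forall>v. \<alpha> C x v = \<beta> C x v)"

definition form_wedge :: "nat \<Rightarrow> nat \<Rightarrow> 'a dform \<Rightarrow> 'a dform \<Rightarrow> 'a dform" where
  "form_wedge k l \<alpha> \<beta> = (\<lambda>C x. wedge k l (\<alpha> C x) (\<beta> C x))"

definition form_contract :: "'a vfield \<Rightarrow> 'a dform \<Rightarrow> 'a dform" where
  "form_contract X \<alpha> = (\<lambda>C x. contract (X C x) (\<alpha> C x))"

text \<open>The value \<open>\<theta>(X)\<close> of a 1-form on a vector field.\<close>

definition pairing :: "'a dform \<Rightarrow> 'a vfield \<Rightarrow> 'a chart \<Rightarrow> real^7 \<Rightarrow> real" where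
  "pairing \<theta> X C x = \<theta> C x (\<lambda>_. X C x)"

text \<open>
  In a chart, \<open>d\<alpha>(v\<^sub>0,\<dots>,v\<^sub>k) = \<Sum>\<^sub>i (-1)\<^sup>i \<partial>\<^sub>v\<^sub>i (\<alpha>(v\<^sub>0,\<dots>,v\<^sub>i omitted,\<dots>,v\<^sub>k))\<close>
  for constant vectors \<open>v\<^sub>i\<close>, where \<open>k\<close> is the degree of \<open>\<alpha>\<close>.
\<close>

definition ext_deriv :: "nat \<Rightarrow> 'a dform \<Rightarrow> 'a dform" where
  "ext_deriv k \<alpha> = (\<lambda>C x v. \<Sum>i\<le>k.
     (- 1) ^ i * frechet_derivative (\<lambda>y. \<alpha> C y (\<lambda>j. v (if j < i then j else Suc j))) (at x) (v i))"

definition twisted_deriv :: "nat \<Rightarrow> 'a dform \<Rightarrow> 'a dform \<Rightarrow> 'a dform" where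
  "twisted_deriv k \<theta> \<alpha> =
     (\<lambda>C x v. ext_deriv k \<alpha> C x v + form_wedge 1 k \<theta> \<alpha> C x v)"

text \<open>Coordinate expression of the bracket \<open>[X, Y]\<close>, that is \<open>[X, Y] f = X (Y f) - Y (X f)\<close>.\<close>

definition lie_bracket ::
  "('v::real_normed_vector \<Rightarrow> 'v) \<Rightarrow> ('v \<Rightarrow> 'v) \<Rightarrow> 'v \<Rightarrow> 'v" where
  "lie_bracket X Y x =
     frechet_derivative Y (at x) (X x) - frechet_derivative X (at x) (Y x)"

text \<open>
  \<open>(L\<^sub>X \<alpha>)(Y\<^sub>1,\<dots>,Y\<^sub>k) = X (\<alpha>(Y\<^sub>1,\<dots>,Y\<^sub>k)) - \<Sum>\<^sub>i \<alpha>(Y\<^sub>1,\<dots>,[X, Y\<^sub>i],\<dots>,Y\<^sub>k)\<close>. The right-hand side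
  is tensorial in the vector fields \<open>Y\<^sub>i\<close>, so at a point of a chart it may be evaluated on the
  fields that are constant in the coordinates.
\<close>

definition lie_deriv :: "nat \<Rightarrow> 'a vfield \<Rightarrow> 'a dform \<Rightarrow> 'a dform" where
  "lie_deriv k X \<alpha> = (\<lambda>C x v.
     frechet_derivative (\<lambda>y. \<alpha> C y v) (at x) (X C x)
     - (\<Sum>i<k. \<alpha> C x (v(i := lie_bracket (X C) (\<lambda>_. v i) x))))"


section \<open>Locally conformal calibrated \<open>G\<^sub>2\<close>-structures\<close>

definition g2_structure :: "'a chart set \<Rightarrow> 'a dform \<Rightarrow> bool" where
  "g2_structure A \<phi> \<longleftrightarrow>
     differential_form A 3 \<phi> \<and> (\<forall>C\<in>A. \<forall>x\<in>chart_image C. g2_form (\<phi> C x))"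

definition lcc_g2_structure :: "'a chart set \<Rightarrow> 'a dform \<Rightarrow> 'a dform \<Rightarrow> bool" where
  "lcc_g2_structure A \<phi> \<theta> \<longleftrightarrow>
     g2_structure A \<phi> \<and>
     differential_form A 1 \<theta> \<and>
     form_eq A (ext_deriv 1 \<theta>) (\<lambda>C x v. 0) \<and>
     (\<forall>C\<in>A. \<forall>x\<in>chart_image C. \<exists>v. \<theta> C x v \<noteq> 0) \<and>
     form_eq A (ext_deriv 3 \<phi>) (\<lambda>C x v. - form_wedge 1 3 \<theta> \<phi> C x v)"

definition metric_dual :: "'a chart set \<Rightarrow> 'a dform \<Rightarrow> 'a dform \<Rightarrow> 'a vfield \<Rightarrow> bool" where
  "metric_dual A \<phi> \<theta> X \<longleftrightarrow>
     (\<forall>C\<in>A. \<forall>x\<in>chart_image C. \<forall>u. \<theta> C x (\<lambda>_. u) = g2_metric (\<phi> C x) (X C x) u)"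

end

theory Submission
  imports Defs
begin

text \<open>
  Put \<open>f = \<theta>(X)\<close>. Cartan's formula and \<open>d\<phi> = - \<theta> \<and> \<phi>\<close> give
  \<open>L\<^sub>X \<phi> = d\<omega> + i\<^sub>X d\<phi> = d\<omega> - f \<phi> + \<theta> \<and> \<omega> = d\<^sub>\<theta> \<omega> - f \<phi>\<close>,
  which is the asserted equivalence.

  Suppose now that \<open>f \<phi> = d\<^sub>\<theta> \<omega>\<close>. As \<open>\<theta>\<close> is closed, \<open>d\<^sub>\<theta> d\<^sub>\<theta> = 0\<close>, and as \<open>d\<^sub>\<theta> \<phi> = 0\<close>, applying
  \<open>d\<^sub>\<theta>\<close> leaves \<open>df \<and> \<phi> = 0\<close>. Wedging 1-forms with a \<open>G\<^sub>2\<close>-form is injective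
  (\<open>g2_form_wedge_1_injective\<close>), so \<open>df = 0\<close> and \<open>f\<close> is constant because \<open>M\<close> is connected.

  The metric makes \<open>f = |X|\<^sup>2\<close> positive. Its definition describes it by a unique existence property,
  which has to be justified: in a coframe adapted to \<open>\<phi>\<close> the only solution is
  \<open>\<Sum>\<^sub>i e\<^sup>i \<otimes> e\<^sup>i\<close> (\<open>g2_metric_coframe\<close>).

  Three devices keep the multilinear algebra small.

  \<^item> The wedge product with a 1-form, the exterior derivative and \<open>d\<^sub>\<theta>\<close> are all alternations
    \<open>\<Sum>\<^sub>i (-1)\<^sup>i T(v\<^sub>i)(v\<^sub>0, \<dots>, v\<^sub>i omitted, \<dots>, v\<^sub>k)\<close> of a form-valued linear map \<open>T\<close>. Alternating twice
    kills everything symmetric in the two first arguments (\<open>alternation_alternation_symmetric\<close>);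
    this covers \<open>a \<and> b = - b \<and> a\<close> as well as \<open>d\<^sub>\<theta> d\<^sub>\<theta> = 0\<close>.

  \<^item> \<open>d\<^sub>\<theta>\<close> is the alternation of the connection \<open>\<nabla>\<^sub>u = \<partial>\<^sub>u + \<theta>(u)\<close>. For closed \<open>\<theta>\<close> this connection is
    flat, which by symmetry of second derivatives (\<open>dir_deriv_commute\<close>) gives \<open>d\<^sub>\<theta> d\<^sub>\<theta> = 0\<close> without a
    product rule for \<open>d(\<theta> \<and> \<omega>)\<close>.

  \<^item> The 7-form \<open>i\<^sub>x \<phi> \<and> i\<^sub>y \<phi> \<and> \<phi>\<close> is a sum over permutations of seven arguments. It is
    computed by treating forms as lists of signed index lists: associativity in the one case
    \<open>(a \<and> b) \<and> c = a \<and> (b \<and> c)\<close> for 1-forms \<open>a, b\<close> turns it into iterated products of 1-forms, which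
    are sorted by anticommutativity.
\<close>

section \<open>Alternation over one more argument\<close>

text \<open>The face map of simplicial sets: the increasing map that misses \<open>i\<close>.\<close>

definition skip :: "nat \<Rightarrow> nat \<Rightarrow> nat" where
  "skip i j = (if j < i then j else Suc j)"

text \<open>
  If \<open>T u\<close> is a \<open>k\<close>-form depending linearly on \<open>u\<close>, this is the \<open>(k + 1)\<close>-form obtained from
  \<open>(u, w) \<mapsto> T u w\<close> by antisymmetrisation. \<open>T u = a(u) b\<close> yields \<open>a \<and> b\<close>, and
  \<open>T u = \<partial>\<^sub>u \<alpha>\<close> yields \<open>d\<alpha>\<close>.
\<close>

definition alternation :: "nat \<Rightarrow> ('v \<Rightarrow> 'v covec) \<Rightarrow> 'v covec" where
  "alternation k T v = (\<Sum>i\<le>k. (- 1) ^ i * T (v i) (\<lambda>j. v (skip i j)))"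

lemma inj_skip: "inj (skip i)"
  by (auto simp: inj_def skip_def split: if_splits)

lemma skip_neq [simp]: "skip i j \<noteq> i" "i \<noteq> skip i j"
  by (auto simp: skip_def)

lemma skip_surj: "i \<noteq> j \<Longrightarrow> \<exists>m. j = skip i m"
  by (rule exI[of _ "if j < i then j else j - 1"]) (auto simp: skip_def)

lemma skip_skip: "j < i \<Longrightarrow> skip i (skip j m) = skip j (skip (i - 1) m)"
  by (auto simp: skip_def)

lemma fun_upd_skip: "(\<lambda>m. (v(i := u)) (skip i m)) = (\<lambda>m. v (skip i m))"
  by (auto simp: skip_def)

lemma fun_upd_skip_other: "(\<lambda>m. (v(skip i j := u)) (skip i m)) = (\<lambda>m. v (skip i m))(j := u)"
  using inj_skip[of i] by (auto simp: inj_def)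

lemma case_nat_fun_upd: "case_nat u (v(i := w)) = (case_nat u v)(Suc i := w)"
  by (auto split: nat.split)

subsection \<open>Expanding permutations along their value at zero\<close>

text \<open>
  A permutation of \<open>0, \<dots>, n\<close> is its value \<open>r\<close> at \<open>0\<close> together with a permutation of the \<open>n\<close> remaining
  indices, transported to the complement of \<open>r\<close> by \<open>skip r\<close>.
\<close>

lemma permutes_case_nat_skip:
  assumes r: "r \<le> n" and t: "\<tau> permutes {..<n}"
  shows "case_nat r (\<lambda>j. skip r (\<tau> j)) permutes {..<Suc n}"
proof -
  let ?s = "case_nat r (\<lambda>j. skip r (\<tau> j))"
  have inj: "inj ?s"
  proof (rule injI)
    fix x y assume "?s x = ?s y"
    then show "x = y"
      by (cases x; cases y) (auto dest!: injD[OF inj_skip] injD[OF permutes_inj[OF t]])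
  qed
  have sub: "?s i < Suc n" if "i < Suc n" for i
  proof (cases i)
    case (Suc j)
    then have "\<tau> j < n" using that permutes_in_image[OF t, of j] by auto
    then show ?thesis using Suc by (auto simp: skip_def)
  qed (use r in auto)
  have fix_: "?s i = i" if "i \<notin> {..<Suc n}" for i
  proof (cases i)
    case (Suc j)
    then have "\<tau> j = j" using that permutes_not_in[OF t] by auto
    then show ?thesis using Suc that r by (auto simp: skip_def)
  qed (use that in auto)
  have "?s ` {..<Suc n} = {..<Suc n}"
  proof (rule endo_inj_surj)
    show "?s ` {..<Suc n} \<subseteq> {..<Suc n}"
      using sub by blast
  qed (use inj inj_on_subset in blast)+
  then have "bij_betw ?s {..<Suc n} {..<Suc n}"
    using inj_on_subset[OF inj] by (simp add: bij_betw_def)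
  then show ?thesis
    using fix_ by (rule bij_imp_permutes)
qed

text \<open>
  The map below is injective, and both sides have \<open>(n + 1) * n! = (n + 1)!\<close> elements.
\<close>

lemma bij_betw_case_nat_skip:
  "bij_betw (\<lambda>(r, \<tau>). case_nat r (\<lambda>j. skip r (\<tau> j)))
     ({..n} \<times> {\<tau>. \<tau> permutes {..<n}}) {\<sigma>. \<sigma> permutes {..<Suc n}}"
    (is "bij_betw ?f ?A ?B")
proof -
  have inj: "inj_on ?f ?A"
  proof (rule inj_onI, clarify)
    fix r r' :: nat and \<tau> \<tau>' :: "nat \<Rightarrow> nat"
    assume eq: "case_nat r (\<lambda>j. skip r (\<tau> j)) = case_nat r' (\<lambda>j. skip r' (\<tau>' j))"
    have r: "r = r'" using fun_cong[OF eq, of 0] by simp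
    have "\<tau> j = \<tau>' j" for j
      using fun_cong[OF eq, of "Suc j"] r injD[OF inj_skip] by auto
    then show "r = r' \<and> \<tau> = \<tau>'" using r by auto
  qed
  have sub: "?f ` ?A \<subseteq> ?B"
    using permutes_case_nat_skip by auto
  have "card (?f ` ?A) = card ?B"
    using inj by (simp add: card_image card_cartesian_product card_permutations[OF refl])
  then have "?f ` ?A = ?B"
    using sub by (intro card_subset_eq) (auto simp: finite_permutations)
  then show ?thesis using inj by (simp add: bij_betw_def)
qed

lemma sign_case_nat_Suc:
  assumes "\<tau> permutes {..<n}"
  shows "sign (case_nat 0 (\<lambda>j. Suc (\<tau> j))) = sign \<tau>"
  using assms finite_lessThan
proof (induction rule: permutes_induct)
  case id
  have "case_nat 0 (\<lambda>j. Suc (id j)) = id"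
    by (auto simp: fun_eq_iff split: nat.split)
  then show ?case by (simp only: sign_id)
next
  case (swap a b p)
  have "case_nat 0 (\<lambda>j. Suc ((Transposition.transpose a b \<circ> p) j))
      = Transposition.transpose (Suc a) (Suc b) \<circ> case_nat 0 (\<lambda>j. Suc (p j))"
    by (auto simp: fun_eq_iff Transposition.transpose_def split: nat.split)
  moreover have "permutation (case_nat 0 (\<lambda>j. Suc (p j)))"
    using permutes_imp_permutation[OF _ permutes_case_nat_skip[of 0 n p]] swap by (simp add: skip_def)
  moreover have "permutation p" using swap by (intro permutes_imp_permutation[of "{..<n}"]) auto
  ultimately have "sign (case_nat 0 (\<lambda>j. Suc ((Transposition.transpose a b \<circ> p) j)))
      = - sign (case_nat 0 (\<lambda>j. Suc (p j)))"
    and "sign (Transposition.transpose a b \<circ> p) = - sign p"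
    using swap by (simp_all only: sign_compose permutation_swap_id sign_swap_id) auto
  then show ?case using swap by (simp only:)
qed

text \<open>The inverse of the cycle \<open>(0 1 \<dots> r)\<close>, a product of \<open>r\<close> adjacent transpositions.\<close>

lemma sign_case_nat_skip_cycle: "sign (case_nat r (skip r)) = (- 1) ^ r"
proof (induction r)
  case 0
  have "case_nat 0 (skip 0) = id"
    by (auto simp: fun_eq_iff skip_def split: nat.split)
  then show ?case by (simp only: sign_id power_0)
next
  case (Suc r)
  have "case_nat (Suc r) (skip (Suc r)) = Transposition.transpose r (Suc r) \<circ> case_nat r (skip r)"
    by (auto simp: fun_eq_iff Transposition.transpose_def skip_def split: nat.split)
  moreover have "permutation (case_nat r (skip r))"
    using permutes_imp_permutation[OF _ permutes_case_nat_skip[of r r id]] by (simp add: permutes_id)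
  ultimately have "sign (case_nat (Suc r) (skip (Suc r))) = - sign (case_nat r (skip r))"
    by (simp only: sign_compose permutation_swap_id sign_swap_id) auto
  then show ?case using Suc by simp
qed

lemma sign_case_nat_skip:
  assumes r: "r \<le> n" and t: "\<tau> permutes {..<n}"
  shows "sign (case_nat r (\<lambda>j. skip r (\<tau> j))) = (- 1) ^ r * sign \<tau>"
proof -
  have "case_nat r (\<lambda>j. skip r (\<tau> j)) = case_nat r (skip r) \<circ> case_nat 0 (\<lambda>j. Suc (\<tau> j))"
    by (auto simp: fun_eq_iff split: nat.split)
  moreover have "permutation (case_nat r (skip r))"
    using permutes_imp_permutation[OF _ permutes_case_nat_skip[of r r id]] by (simp add: permutes_id)
  moreover have "permutation (case_nat 0 (\<lambda>j. Suc (\<tau> j)))"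
    using permutes_imp_permutation[OF _ permutes_case_nat_skip[OF _ t, of 0]] by (simp add: skip_def)
  ultimately show ?thesis
    by (simp only: sign_compose sign_case_nat_skip_cycle sign_case_nat_Suc[OF t])
qed

text \<open>The bookkeeping behind the Laplace expansion of a determinant along its first row.\<close>

lemma sum_permutes_lessThan_Suc:
  fixes F :: "(nat \<Rightarrow> nat) \<Rightarrow> real"
  shows "(\<Sum>\<sigma> | \<sigma> permutes {..<Suc n}. of_int (sign \<sigma>) * F \<sigma>) =
    (\<Sum>r\<le>n. (- 1) ^ r * (\<Sum>\<tau> | \<tau> permutes {..<n}.
        of_int (sign \<tau>) * F (case_nat r (\<lambda>j. skip r (\<tau> j)))))"
proof -
  have "(\<Sum>\<sigma> | \<sigma> permutes {..<Suc n}. of_int (sign \<sigma>) * F \<sigma>) =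
      (\<Sum>(r, \<tau>) \<in> {..n} \<times> {\<tau>. \<tau> permutes {..<n}}.
        (- 1) ^ r * (of_int (sign \<tau>) * F (case_nat r (\<lambda>j. skip r (\<tau> j)))))"
    unfolding sum.reindex_bij_betw[OF bij_betw_case_nat_skip, symmetric]
    by (intro sum.cong) (auto simp: sign_case_nat_skip)
  then show ?thesis
    by (simp add: sum.cartesian_product[symmetric] sum_distrib_left)
qed

subsection \<open>Alternating forms\<close>

lemma alternating_form_cong:
  "alternating_form k a \<Longrightarrow> (\<And>i. i < k \<Longrightarrow> v i = w i) \<Longrightarrow> a v = a w"
  by (auto simp: alternating_form_def)

lemma alternating_form_linear:
  "alternating_form k a \<Longrightarrow> i < k \<Longrightarrow> linear (\<lambda>u. a (v(i := u)))"
  by (auto simp: alternating_form_def)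

lemma alternating_form_eq_0:
  "alternating_form k a \<Longrightarrow> i < k \<Longrightarrow> j < k \<Longrightarrow> i \<noteq> j \<Longrightarrow> v i = v j \<Longrightarrow> a v = 0"
  by (auto simp: alternating_form_def)

lemma alternating_form_1: "alternating_form 1 a \<Longrightarrow> a v = a (\<lambda>_. v 0)"
  by (erule alternating_form_cong) simp

lemma alternating_form_1_linear:
  assumes "alternating_form 1 a"
  shows "linear (\<lambda>u. a (\<lambda>_. u))"
proof -
  have "a (v(0 := u)) = a (\<lambda>_. u)" for u and v :: "nat \<Rightarrow> 'a"
    using alternating_form_1[OF assms, of "v(0 := u)"] by simp
  then show ?thesis using alternating_form_linear[OF assms, of 0] by simp
qed

text \<open>Polarise \<open>a(\<dots>, x + y, \<dots>, x + y, \<dots>) = 0\<close>.\<close>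

lemma alternating_form_transpose:
  assumes a: "alternating_form k a" and i: "i < k" "j < k" "i \<noteq> j"
  shows "a (\<lambda>m. v (Transposition.transpose i j m)) = - a v"
proof -
  define B where "B x y = a (v(i := x, j := y))" for x y
  have lin1: "linear (\<lambda>x. B x y)" for y
    using alternating_form_linear[OF a i(1), of "v(j := y)"] i(3)
    by (simp add: B_def fun_upd_twist)
  have lin2: "linear (B x)" for x
    using alternating_form_linear[OF a i(2), of "v(i := x)"] by (simp add: B_def[abs_def])
  have diag: "B x x = 0" for x
    unfolding B_def using i by (intro alternating_form_eq_0[OF a, of i j]) auto
  have "B (v i + v j) (v i + v j) = B (v i) (v i) + B (v i) (v j) + B (v j) (v i) + B (v j) (v j)"
    by (simp add: linear_add[OF lin1] linear_add[OF lin2])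
  then have "B (v j) (v i) = - B (v i) (v j)" by (simp add: diag)
  moreover have "B (v i) (v j) = a v" by (simp add: B_def)
  moreover have "(\<lambda>m. v (Transposition.transpose i j m)) = v(i := v j, j := v i)"
    using i by (auto simp: Transposition.transpose_def)
  ultimately show ?thesis by (simp add: B_def)
qed

lemma alternating_form_permute:
  assumes a: "alternating_form k a" and p: "\<sigma> permutes {..<k}"
  shows "a (\<lambda>i. v (\<sigma> i)) = of_int (sign \<sigma>) * a v"
  using p finite_lessThan
proof (induction arbitrary: v rule: permutes_induct)
  case id
  show ?case by (simp add: sign_id[unfolded id_def])
next
  case (swap i j p)
  have "a (\<lambda>m. v (Transposition.transpose i j (p m))) = of_int (sign p) * a (\<lambda>m. v (Transposition.transpose i j m))"
    using swap.IH[of "\<lambda>m. v (Transposition.transpose i j m)"] by simp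
  also have "\<dots> = - of_int (sign p) * a v"
    using swap alternating_form_transpose[OF a] by simp
  moreover have "sign (Transposition.transpose i j \<circ> p) = - sign p"
    using swap permutes_imp_permutation[OF finite_lessThan, of p k]
    by (subst sign_compose) (auto simp: permutation_swap_id sign_swap_id)
  ultimately show ?case by (simp add: comp_def)
qed

lemma alternating_form_scale:
  assumes a: "alternating_form k a"
  shows "a (\<lambda>i. c *\<^sub>R v i) = c ^ k * a v"
proof -
  have "a (\<lambda>i. if i < n then c *\<^sub>R v i else v i) = c ^ n * a v" if "n \<le> k" for n
    using that
  proof (induction n)
    case (Suc n)
    have 1: "(\<lambda>i. if i < Suc n then c *\<^sub>R v i else v i)
        = (\<lambda>i. if i < n then c *\<^sub>R v i else v i)(n := c *\<^sub>R v n)"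
      by (auto simp: less_Suc_eq)
    have 2: "(\<lambda>i. if i < n then c *\<^sub>R v i else v i)(n := v n)
        = (\<lambda>i. if i < n then c *\<^sub>R v i else v i)"
      by auto
    have "n < k" using Suc by simp
    from linear_scale[OF alternating_form_linear[OF a this]] show ?case
      unfolding 1 using Suc by (simp add: 2)
  qed simp
  from this[of k] alternating_form_cong[OF a, of "\<lambda>i. if i < k then c *\<^sub>R v i else v i"]
  show ?thesis by simp
qed

lemma alternating_form_0: "alternating_form k (\<lambda>_. 0)"
  by (simp add: alternating_form_def linear_zero)

lemma alternating_form_add:
  assumes a: "alternating_form k a" and b: "alternating_form k b"
  shows "alternating_form k (\<lambda>v. a v + b v)"
  unfolding alternating_form_def
proof (intro conjI allI impI)
  fix v w :: "nat \<Rightarrow> 'a" assume "\<forall>i<k. v i = w i"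
  then show "a v + b v = a w + b w"
    using alternating_form_cong[OF a, of v w] alternating_form_cong[OF b, of v w] by simp
next
  fix v :: "nat \<Rightarrow> 'a" and i assume "i < k"
  then show "linear (\<lambda>u. a (v(i := u)) + b (v(i := u)))"
    by (intro linear_compose_add alternating_form_linear[OF a] alternating_form_linear[OF b])
next
  fix v :: "nat \<Rightarrow> 'a" and i j assume "i < k" "j < k" "i \<noteq> j \<and> v i = v j"
  then show "a v + b v = 0"
    using alternating_form_eq_0[OF a, of i j v] alternating_form_eq_0[OF b, of i j v] by simp
qed

lemma linear_mult_const: "linear f \<Longrightarrow> linear (\<lambda>u. c * f u)" for c :: real
  using linear_compose[OF _ linear_times] by (auto simp: o_def)

lemma linear_const_mult: "linear f \<Longrightarrow> linear (\<lambda>u. f u * c)" for c :: real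
  using linear_mult_const[of f c] by (simp add: mult.commute)

lemma alternating_form_mult:
  "alternating_form k b \<Longrightarrow> alternating_form k (\<lambda>w. c * b w)"
  unfolding alternating_form_def by (intro conjI allI impI linear_mult_const) auto

lemma alternating_form_contract:
  assumes a: "alternating_form (Suc k) a"
  shows "alternating_form k (contract u a)"
  unfolding alternating_form_def contract_def
proof (intro conjI allI impI)
  fix v w :: "nat \<Rightarrow> 'a" assume "\<forall>i<k. v i = w i"
  then show "a (case_nat u v) = a (case_nat u w)"
    by (intro alternating_form_cong[OF a]) (auto split: nat.split)
next
  fix v :: "nat \<Rightarrow> 'a" and i assume "i < k"
  then show "linear (\<lambda>w. a (case_nat u (v(i := w))))"
    unfolding case_nat_fun_upd by (intro alternating_form_linear[OF a]) auto
next
  fix v :: "nat \<Rightarrow> 'a" and i j assume "i < k" "j < k" "i \<noteq> j \<and> v i = v j"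
  then show "a (case_nat u v) = 0"
    by (intro alternating_form_eq_0[OF a, of "Suc i" "Suc j"]) auto
qed

lemma linear_contract:
  assumes a: "alternating_form (Suc k) a"
  shows "linear (\<lambda>u. contract u a v)"
proof -
  have "(case_nat (undefined::'a) v)(0 := u) = case_nat u v" for u
    by (auto split: nat.split)
  then show ?thesis
    using alternating_form_linear[OF a, of 0 "case_nat undefined v"] by (simp add: contract_def)
qed

text \<open>Moving a slot to the front takes \<open>i\<close> adjacent transpositions.\<close>

lemma alternating_form_front:
  assumes a: "alternating_form (Suc k) a" and i: "i \<le> k"
  shows "a (case_nat u (\<lambda>j. v (skip i j))) = (- 1) ^ i * a (v(i := u))"
proof -
  have p: "case_nat i (skip i) permutes {..<Suc k}"
    using permutes_case_nat_skip[OF i permutes_id] by simp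
  have "(\<lambda>m. (v(i := u)) (case_nat i (skip i) m)) = case_nat u (\<lambda>j. v (skip i j))"
    by (auto simp: fun_eq_iff split: nat.split)
  then show ?thesis
    using alternating_form_permute[OF a p, of "v(i := u)"] by (simp add: sign_case_nat_skip_cycle)
qed

subsection \<open>Properties of the alternation\<close>

lemma alternation_add:
  "alternation k (\<lambda>u w. S u w + T u w) = (\<lambda>v. alternation k S v + alternation k T v)"
  by (simp add: fun_eq_iff alternation_def sum.distrib algebra_simps)

lemma alternation_mult:
  "alternation k (\<lambda>u w. c * T u w) = (\<lambda>v. c * alternation k T v)"
  by (simp add: fun_eq_iff alternation_def sum_distrib_left algebra_simps)

text \<open>
  Contraction with \<open>u\<close>: either \<open>u\<close> is the argument singled out, or it stays in front of the others
  and shifts their positions, hence their signs, by one.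
\<close>

lemma alternation_case_nat:
  "alternation (Suc k) T (case_nat u v) = T u v - alternation k (\<lambda>u' w. T u' (case_nat u w)) v"
proof -
  have 0: "(\<lambda>j. case_nat u v (skip 0 j)) = v" by (auto simp: skip_def)
  have S: "(\<lambda>j. case_nat u v (skip (Suc i) j)) = case_nat u (\<lambda>j. v (skip i j))" for i
    by (auto simp: fun_eq_iff skip_def split: nat.split)
  show ?thesis
    unfolding alternation_def sum.atMost_Suc_shift S 0
    by (simp add: sum_negf)
qed

text \<open>
  The factor \<open>k!\<close> counts the permutations with a given value at \<open>0\<close>; they all contribute the same.
\<close>

lemma alternation_permutations:
  assumes T: "\<And>u. alternating_form k (T u)"
  shows "fact k * alternation k T v =
    (\<Sum>\<sigma> | \<sigma> permutes {..<Suc k}. of_int (sign \<sigma>) * T (v (\<sigma> 0)) (\<lambda>j. v (\<sigma> (Suc j))))"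
proof -
  have *: "(\<Sum>\<tau> | \<tau> permutes {..<k}. of_int (sign \<tau>) * T (v r) (\<lambda>j. v (skip r (\<tau> j))))
      = fact k * T (v r) (\<lambda>j. v (skip r j))" for r
  proof -
    have "of_int (sign \<tau>) * T (v r) (\<lambda>j. v (skip r (\<tau> j))) = T (v r) (\<lambda>j. v (skip r j))"
      if "\<tau> permutes {..<k}" for \<tau>
    proof -
      have "(of_int (sign \<tau>) * of_int (sign \<tau>) :: real) = 1"
        by (metis of_int_1 of_int_mult sign_idempotent)
      then show ?thesis
        using alternating_form_permute[OF T that, of "v r" "\<lambda>j. v (skip r j)"]
        by (simp flip: mult.assoc)
    qed
    then show ?thesis by (simp add: card_permutations[OF refl])
  qed
  show ?thesis
    unfolding sum_permutes_lessThan_Suc alternation_def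
    by (simp add: * sum_distrib_left[of "fact k"] mult.left_commute)
qed

text \<open>
  Linearity is read off the definition. For two equal arguments the sum over permutations changes
  sign under composition with their transposition.
\<close>

lemma alternating_form_alternation:
  assumes T: "\<And>u. alternating_form k (T u)" and lin: "\<And>w. linear (\<lambda>u. T u w)"
  shows "alternating_form (Suc k) (alternation k T)"
  unfolding alternating_form_def
proof (intro conjI allI impI)
  fix v w :: "nat \<Rightarrow> 'a" assume eq: "\<forall>i<Suc k. v i = w i"
  have "T (v i) (\<lambda>j. v (skip i j)) = T (w i) (\<lambda>j. w (skip i j))" if "i \<le> k" for i
    using that eq by (auto intro!: alternating_form_cong[OF T] simp: skip_def)
  then show "alternation k T v = alternation k T w"
    by (simp add: alternation_def)
next
  fix v :: "nat \<Rightarrow> 'a" and i assume i: "i < Suc k"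
  have "linear (\<lambda>u. (- 1) ^ r * T ((v(i := u)) r) (\<lambda>j. (v(i := u)) (skip r j)))" if r: "r \<le> k" for r
  proof (cases "r = i")
    case True
    have "linear (\<lambda>u. T ((v(i := u)) r) (\<lambda>j. (v(i := u)) (skip r j)))"
      unfolding True fun_upd_skip using lin by simp
    from linear_compose[OF this linear_times] show ?thesis by (simp add: o_def)
  next
    case False
    then obtain j where j: "i = skip r j" using skip_surj by blast
    have "j < k" using i r j by (auto simp: skip_def split: if_splits)
    have "linear (\<lambda>u. T ((v(i := u)) r) (\<lambda>j. (v(i := u)) (skip r j)))"
      unfolding j fun_upd_skip_other
      using alternating_form_linear[OF T \<open>j < k\<close>] by simp
    from linear_compose[OF this linear_times] show ?thesis by (simp add: o_def)
  qed
  then show "linear (\<lambda>u. alternation k T (v(i := u)))"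
    unfolding alternation_def by (intro linear_compose_sum) auto
next
  fix v :: "nat \<Rightarrow> 'a" and i j assume ij: "i < Suc k" "j < Suc k" "i \<noteq> j \<and> v i = v j"
  let ?t = "Transposition.transpose i j"
  let ?G = "\<lambda>\<sigma>. of_int (sign \<sigma>) * T (v (\<sigma> 0)) (\<lambda>m. v (\<sigma> (Suc m)))"
  have vt: "v (?t m) = v m" for m using ij by (auto simp: Transposition.transpose_def)
  have "(\<Sum>\<sigma> | \<sigma> permutes {..<Suc k}. ?G \<sigma>) = (\<Sum>\<sigma> | \<sigma> permutes {..<Suc k}. ?G (?t \<circ> \<sigma>))"
    using ij by (intro setum_permutations_compose_left permutes_swap_id) auto
  also have "\<dots> = (\<Sum>\<sigma> | \<sigma> permutes {..<Suc k}. - ?G \<sigma>)"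
  proof (intro sum.cong refl)
    fix \<sigma> assume "\<sigma> \<in> {\<sigma>. \<sigma> permutes {..<Suc k}}"
    then have "permutation \<sigma>" using permutes_imp_permutation[OF finite_lessThan] by blast
    then have "sign (?t \<circ> \<sigma>) = - sign \<sigma>"
      using ij by (simp add: sign_compose permutation_swap_id sign_swap_id)
    then show "?G (?t \<circ> \<sigma>) = - ?G \<sigma>" by (simp add: vt)
  qed
  finally have "fact k * alternation k T v = 0"
    by (simp add: alternation_permutations[OF T] sum_negf)
  then show "alternation k T v = 0" by simp
qed

text \<open>
  The terms in which the arguments with the indices \<open>i \<noteq> j\<close> have been singled out occur twice, once
  for each order, with opposite signs.
\<close>

lemma alternation_alternation_symmetric:
  assumes sym: "\<And>u u' w. T u u' w = T u' u w"
  shows "alternation (Suc k) (\<lambda>u. alternation k (T u)) v = 0"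
proof -
  define F where "F = (\<lambda>(i, j). (- 1) ^ i * ((- 1) ^ j *
      T (v i) (v (skip i j)) (\<lambda>m. v (skip i (skip j m)))))"
  \<comment> \<open>The index pair \<open>(i, j)\<close> singles out the arguments \<open>i\<close> and \<open>skip i j\<close>, so \<open>?A\<close> and \<open>?B\<close> contain
    every pair of arguments once, in opposite orders.\<close>
  let ?A = "{(i, j). i \<le> Suc k \<and> j \<le> k \<and> j < i}"
  let ?B = "{(i, j). i \<le> Suc k \<and> j \<le> k \<and> i \<le> j}"
  have fin: "finite ?A" "finite ?B"
    by (rule finite_subset[of _ "{..Suc k} \<times> {..k}"]; auto)+
  have "alternation (Suc k) (\<lambda>u. alternation k (T u)) v = sum F ({..Suc k} \<times> {..k})"
    unfolding alternation_def F_def sum_distrib_left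
    by (subst sum.cartesian_product) simp
  also have "{..Suc k} \<times> {..k} = ?A \<union> ?B" by auto
  also have "sum F (?A \<union> ?B) = sum F ?A + sum F ?B"
    using fin by (intro sum.union_disjoint) auto
  also have "sum F ?B = (\<Sum>x\<in>?A. - F x)"
  proof (rule sum.reindex_bij_witness[of _ "\<lambda>(i, j). (j, i - 1)" "\<lambda>(i, j). (Suc j, i)"])
    fix x assume "x \<in> ?B"
    then obtain i j where x: "x = (i, j)" "i \<le> j" by auto
    have 1: "skip (Suc j) i = i" "skip i j = Suc j" using x by (auto simp: skip_def)
    have 2: "skip (Suc j) (skip i m) = skip i (skip j m)" for m
      using skip_skip[of i "Suc j" m] x by simp
    show "- F (case x of (i, j) \<Rightarrow> (Suc j, i)) = F x"
      unfolding x F_def by (simp add: 1 2 sym[of "v (Suc j)"])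
  qed auto
  finally show ?thesis by (simp add: sum_negf)
qed

section \<open>The wedge product with a 1-form\<close>

lemma wedge_1_permutations:
  assumes a: "alternating_form 1 a"
  shows "wedge 1 k a b v = (\<Sum>\<sigma> | \<sigma> permutes {..<Suc k}.
    of_int (sign \<sigma>) * (a (\<lambda>_. v (\<sigma> 0)) * b (\<lambda>i. v (\<sigma> (Suc i))))) / fact k"
proof -
  have "a (\<lambda>i. v (\<sigma> i)) = a (\<lambda>_. v (\<sigma> 0))" for \<sigma> :: "nat \<Rightarrow> nat"
    by (rule alternating_form_1[OF a])
  then have "wedge 1 k a b v = (\<Sum>\<sigma> | \<sigma> permutes {..<1 + k}.
      of_int (sign \<sigma>) * a (\<lambda>_. v (\<sigma> 0)) * b (\<lambda>i. v (\<sigma> (1 + i)))) / (fact 1 * fact k)"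
    unfolding wedge_def
    by (intro arg_cong[where f = "\<lambda>x. x / _"] sum.cong refl arg_cong2[where f = "(*)"])
  then show ?thesis by (simp add: mult.assoc)
qed

lemma wedge_1_eq_alternation:
  assumes a: "alternating_form 1 a" and b: "alternating_form k b"
  shows "wedge 1 k a b = alternation k (\<lambda>u w. a (\<lambda>_. u) * b w)"
proof
  fix v
  have "fact k * alternation k (\<lambda>u w. a (\<lambda>_. u) * b w) v = fact k * wedge 1 k a b v"
    unfolding wedge_1_permutations[OF a]
    by (subst alternation_permutations[OF alternating_form_mult[OF b]]) simp
  then show "wedge 1 k a b v = alternation k (\<lambda>u w. a (\<lambda>_. u) * b w) v" by simp
qed

lemma alternating_form_wedge_1:
  assumes a: "alternating_form 1 a" and b: "alternating_form k b"
  shows "alternating_form (Suc k) (wedge 1 k a b)"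
  unfolding wedge_1_eq_alternation[OF a b]
  by (intro alternating_form_alternation alternating_form_mult[OF b] linear_const_mult
      alternating_form_1_linear[OF a])

text \<open>Contraction is an antiderivation.\<close>

lemma contract_wedge_1:
  assumes a: "alternating_form 1 a" and b: "alternating_form (Suc k) b"
  shows "contract u (wedge 1 (Suc k) a b) v = a (\<lambda>_. u) * b v - wedge 1 k a (contract u b) v"
  unfolding wedge_1_eq_alternation[OF a b]
    wedge_1_eq_alternation[OF a alternating_form_contract[OF b]]
  by (simp add: contract_def alternation_case_nat)

lemma wedge_1_anticommute:
  assumes a: "alternating_form 1 a" and b: "alternating_form 1 b" and c: "alternating_form k c"
  shows "wedge 1 (Suc k) a (wedge 1 k b c) v = - wedge 1 (Suc k) b (wedge 1 k a c) v"
proof -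
  have W: "wedge 1 (Suc k) a (wedge 1 k b c) v
      = alternation (Suc k) (\<lambda>u. alternation k (\<lambda>u' w. a (\<lambda>_. u) * (b (\<lambda>_. u') * c w))) v"
    if a: "alternating_form 1 a" and b: "alternating_form 1 b" for a b
    by (subst wedge_1_eq_alternation[OF a alternating_form_wedge_1[OF b c]])
      (simp only: wedge_1_eq_alternation[OF b c] alternation_mult)
  have "wedge 1 (Suc k) a (wedge 1 k b c) v + wedge 1 (Suc k) b (wedge 1 k a c) v
      = alternation (Suc k) (\<lambda>u. alternation k (\<lambda>u' w.
          a (\<lambda>_. u) * (b (\<lambda>_. u') * c w) + b (\<lambda>_. u) * (a (\<lambda>_. u') * c w))) v"
    unfolding W[OF a b] W[OF b a] alternation_add ..
  also have "\<dots> = 0"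
    by (rule alternation_alternation_symmetric) (simp add: algebra_simps)
  finally show ?thesis by simp
qed

lemma wedge_1_idem:
  assumes "alternating_form 1 a" and "alternating_form k c"
  shows "wedge 1 (Suc k) a (wedge 1 k a c) v = 0"
  using wedge_1_anticommute[OF assms(1) assms] by simp

lemma wedge_1_1:
  assumes a: "alternating_form 1 a" and b: "alternating_form 1 b"
  shows "wedge 1 1 a b u = a (\<lambda>_. u 0) * b (\<lambda>_. u 1) - a (\<lambda>_. u 1) * b (\<lambda>_. u 0)"
proof -
  have "b (\<lambda>j. u (skip i j)) = b (\<lambda>_. u (skip i 0))" for i
    by (rule alternating_form_1[OF b])
  then show ?thesis
    unfolding wedge_1_eq_alternation[OF a b] alternation_def
    by simp (simp add: skip_def)
qed

text \<open>
  Associativity for two 1-forms: \<open>a \<and> b\<close> antisymmetrises \<open>(u, u') \<mapsto> a(u) b(u')\<close>, which the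
  outer wedge product does anyway.
\<close>

lemma wedge_2_wedge_1:
  assumes a: "alternating_form 1 a" and b: "alternating_form 1 b" and c: "alternating_form l c"
  shows "wedge 2 l (wedge 1 1 a b) c = wedge 1 (Suc l) a (wedge 1 l b c)"
proof
  fix v
  let ?P = "{\<sigma>. \<sigma> permutes {..<Suc (Suc l)}}"
  define F where "F i j \<sigma> = a (\<lambda>_. v (\<sigma> i)) * b (\<lambda>_. v (\<sigma> j)) * c (\<lambda>m. v (\<sigma> (Suc (Suc m))))"
    for i j and \<sigma> :: "nat \<Rightarrow> nat"
  let ?t = "Transposition.transpose 0 (Suc 0)"
  have "(\<Sum>\<sigma>\<in>?P. of_int (sign \<sigma>) * F 1 0 \<sigma>) = (\<Sum>\<sigma>\<in>?P. of_int (sign (\<sigma> \<circ> ?t)) * F 1 0 (\<sigma> \<circ> ?t))"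
    by (intro sum_permutations_compose_right permutes_swap_id) auto
  also have "\<dots> = (\<Sum>\<sigma>\<in>?P. - (of_int (sign \<sigma>) * F 0 1 \<sigma>))"
  proof (intro sum.cong refl)
    fix \<sigma> assume "\<sigma> \<in> ?P"
    then have "permutation \<sigma>" using permutes_imp_permutation[OF finite_lessThan] by blast
    then have "sign (\<sigma> \<circ> ?t) = - sign \<sigma>"
      by (simp add: sign_compose permutation_swap_id sign_swap_id)
    moreover have "F 1 0 (\<sigma> \<circ> ?t) = F 0 1 \<sigma>"
      by (simp add: F_def Transposition.transpose_def)
    ultimately show "of_int (sign (\<sigma> \<circ> ?t)) * F 1 0 (\<sigma> \<circ> ?t) = - (of_int (sign \<sigma>) * F 0 1 \<sigma>)"
      by simp
  qed
  finally have swap: "(\<Sum>\<sigma>\<in>?P. of_int (sign \<sigma>) * F 1 0 \<sigma>) = - (\<Sum>\<sigma>\<in>?P. of_int (sign \<sigma>) * F 0 1 \<sigma>)"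
    by (simp add: sum_negf)
  have "wedge 2 l (wedge 1 1 a b) c v
      = (\<Sum>\<sigma>\<in>?P. of_int (sign \<sigma>) * F 0 1 \<sigma> - of_int (sign \<sigma>) * F 1 0 \<sigma>) / (2 * fact l)"
    unfolding wedge_def[of 2 l] wedge_1_1[OF a b] F_def by (simp add: algebra_simps)
  also have "\<dots> = (\<Sum>\<sigma>\<in>?P. of_int (sign \<sigma>) * F 0 1 \<sigma>) / fact l"
    unfolding sum_subtractf swap by simp
  also have "\<dots> = wedge 1 (Suc l) a (wedge 1 l b c) v"
    unfolding sum_permutes_lessThan_Suc[where n = "Suc l"]
      wedge_1_eq_alternation[OF a alternating_form_wedge_1[OF b c]]
      alternation_def wedge_1_permutations[OF b] F_def
    unfolding sum_divide_distrib[of _ "{..Suc l}"]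
    by (intro sum.cong refl) (simp add: sum_divide_distrib sum_distrib_left mult_ac)
  finally show "wedge 2 l (wedge 1 1 a b) c v = wedge 1 (Suc l) a (wedge 1 l b c) v" .
qed

section \<open>Functions of class \<open>C\<^sup>k\<close>\<close>

abbreviation dir_deriv :: "('v::real_normed_vector \<Rightarrow> 'w::real_normed_vector) \<Rightarrow> 'v \<Rightarrow> 'v \<Rightarrow> 'w" where
  "dir_deriv f x u \<equiv> frechet_derivative f (at x) u"

lemma smooth_on_imp_Ck_on: "smooth_on S f \<Longrightarrow> Ck_on k S f"
  by (simp add: smooth_on_def)

lemma Ck_on_differentiable: "Ck_on (Suc k) S f \<Longrightarrow> x \<in> S \<Longrightarrow> f differentiable (at x)"
  by simp

lemma smooth_on_differentiable: "smooth_on S f \<Longrightarrow> x \<in> S \<Longrightarrow> f differentiable (at x)"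
  using Ck_on_differentiable smooth_on_imp_Ck_on by blast

lemma Ck_on_SucD: "Ck_on (Suc k) S f \<Longrightarrow> Ck_on k S f"
proof (induction k arbitrary: f)
  case 0
  then show ?case
    by (auto intro!: continuous_at_imp_continuous_on differentiable_imp_continuous_within)
qed auto

lemma Ck_on_cong:
  assumes S: "open S"
  shows "(\<And>x. x \<in> S \<Longrightarrow> f x = g x) \<Longrightarrow> Ck_on k S f \<Longrightarrow> Ck_on k S g"
proof (induction k arbitrary: f g)
  case 0
  then show ?case by (metis Ck_on.simps(1) continuous_on_cong)
next
  case (Suc k)
  have d: "g differentiable (at x)" "dir_deriv f x = dir_deriv g x" if "x \<in> S" for x
  proof -
    have "f differentiable (at x)" using Suc.prems that by simp
    then show "dir_deriv f x = dir_deriv g x"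
      using frechet_derivative_transform_within_open[OF _ S that] Suc.prems by blast
    show "g differentiable (at x)"
      using \<open>f differentiable (at x)\<close> has_derivative_transform_within_open[OF _ S that] Suc.prems(1)
      unfolding differentiable_def by metis
  qed
  show ?case
    unfolding Ck_on.simps
  proof (intro conjI ballI allI)
    fix v show "Ck_on k S (\<lambda>x. dir_deriv g x v)"
      by (rule Suc.IH[of "\<lambda>x. dir_deriv f x v"]) (use Suc.prems d in auto)
  qed (use d in auto)
qed

lemma Ck_on_const: "Ck_on k S (\<lambda>x. c)"
  by (induction k arbitrary: c) auto

lemma dir_deriv_add:
  assumes "f differentiable (at x)" and "g differentiable (at x)"
  shows "dir_deriv (\<lambda>y. f y + g y) x u = dir_deriv f x u + dir_deriv g x u"
  using has_derivative_add[OF assms[unfolded frechet_derivative_works]]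
  by (metis frechet_derivative_at)

lemma dir_deriv_mult:
  fixes f g :: "'v::real_normed_vector \<Rightarrow> real"
  assumes "f differentiable (at x)" and "g differentiable (at x)"
  shows "dir_deriv (\<lambda>y. f y * g y) x u = dir_deriv f x u * g x + f x * dir_deriv g x u"
proof -
  have "((\<lambda>y. f y * g y) has_derivative (\<lambda>u. f x * dir_deriv g x u + dir_deriv f x u * g x)) (at x)"
    using has_derivative_mult[OF assms[unfolded frechet_derivative_works]] .
  then have "dir_deriv (\<lambda>y. f y * g y) x = (\<lambda>u. f x * dir_deriv g x u + dir_deriv f x u * g x)"
    by (rule frechet_derivative_at[symmetric])
  then show ?thesis by simp
qed

lemma dir_deriv_sum:
  assumes "\<And>i. i \<in> I \<Longrightarrow> f i differentiable (at x)"
  shows "dir_deriv (\<lambda>y. \<Sum>i\<in>I. f i y) x u = (\<Sum>i\<in>I. dir_deriv (f i) x u)"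
proof -
  have "((\<lambda>y. \<Sum>i\<in>I. f i y) has_derivative (\<lambda>u. \<Sum>i\<in>I. dir_deriv (f i) x u)) (at x)"
    using assms frechet_derivative_works by (intro has_derivative_sum) blast
  then show ?thesis
    by (metis frechet_derivative_at)
qed

lemma dir_deriv_cmult:
  fixes f :: "'v::real_normed_vector \<Rightarrow> real"
  assumes "f differentiable (at x)"
  shows "dir_deriv (\<lambda>y. c * f y) x u = c * dir_deriv f x u"
  using dir_deriv_mult[OF differentiable_const assms, of c] by simp

lemma dir_deriv_inner:
  fixes f :: "'v::real_normed_vector \<Rightarrow> 'w::real_inner"
  assumes "f differentiable (at x)"
  shows "dir_deriv (\<lambda>y. f y \<bullet> b) x u = dir_deriv f x u \<bullet> b"
proof -
  have "((\<lambda>y. f y \<bullet> b) has_derivative (\<lambda>u. dir_deriv f x u \<bullet> b)) (at x)"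
    using has_derivative_inner_left[OF assms[unfolded frechet_derivative_works]] .
  then show ?thesis
    by (metis frechet_derivative_at)
qed

lemma differentiable_inner_const:
  fixes f :: "'v::real_normed_vector \<Rightarrow> 'w::real_inner"
  shows "f differentiable (at x) \<Longrightarrow> (\<lambda>y. f y \<bullet> b) differentiable (at x)"
  unfolding differentiable_def using has_derivative_inner_left by blast

lemma Ck_on_add:
  assumes S: "open S"
  shows "Ck_on k S f \<Longrightarrow> Ck_on k S g \<Longrightarrow> Ck_on k S (\<lambda>x. f x + g x)"
proof (induction k arbitrary: f g)
  case (Suc k)
  show ?case
    unfolding Ck_on.simps
  proof (intro conjI ballI allI)
    fix v show "Ck_on k S (\<lambda>x. dir_deriv (\<lambda>x. f x + g x) x v)"
      by (rule Ck_on_cong[OF S _ Suc.IH[of "\<lambda>x. dir_deriv f x v" "\<lambda>x. dir_deriv g x v"]])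
        (use Suc.prems in \<open>auto simp: dir_deriv_add\<close>)
  qed (use Suc.prems in auto)
qed (auto intro: continuous_on_add)

lemma Ck_on_mult:
  fixes f g :: "'v::real_normed_vector \<Rightarrow> real"
  assumes S: "open S"
  shows "Ck_on k S f \<Longrightarrow> Ck_on k S g \<Longrightarrow> Ck_on k S (\<lambda>x. f x * g x)"
proof (induction k arbitrary: f g)
  case (Suc k)
  have fg: "Ck_on k S f" "Ck_on k S g" using Suc.prems Ck_on_SucD by blast+
  show ?case
    unfolding Ck_on.simps
  proof (intro conjI ballI allI)
    fix v
    have "Ck_on k S (\<lambda>x. dir_deriv f x v * g x + f x * dir_deriv g x v)"
      using Suc.prems fg by (intro Ck_on_add[OF S] Suc.IH) auto
    then show "Ck_on k S (\<lambda>x. dir_deriv (\<lambda>x. f x * g x) x v)"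
      by (rule Ck_on_cong[OF S, rotated]) (use Suc.prems in \<open>simp add: dir_deriv_mult\<close>)
  qed (use Suc.prems in auto)
qed (auto intro: continuous_on_mult)

lemma Ck_on_sum:
  assumes S: "open S"
  shows "(\<And>i. i \<in> I \<Longrightarrow> Ck_on k S (f i)) \<Longrightarrow> Ck_on k S (\<lambda>x. \<Sum>i\<in>I. f i x)"
  by (induction I rule: infinite_finite_induct) (auto intro: Ck_on_add[OF S] Ck_on_const)

lemma Ck_on_inner:
  fixes f :: "'v::real_normed_vector \<Rightarrow> 'w::real_inner"
  assumes S: "open S"
  shows "Ck_on k S f \<Longrightarrow> Ck_on k S (\<lambda>x. f x \<bullet> b)"
proof (induction k arbitrary: f)
  case (Suc k)
  show ?case
    unfolding Ck_on.simps
  proof (intro conjI ballI allI)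
    fix v show "Ck_on k S (\<lambda>x. dir_deriv (\<lambda>x. f x \<bullet> b) x v)"
      by (rule Ck_on_cong[OF S _ Suc.IH[of "\<lambda>x. dir_deriv f x v"]])
        (use Suc.prems in \<open>auto simp: dir_deriv_inner\<close>)
  qed (use Suc.prems differentiable_inner_const in auto)
qed (auto intro: continuous_intros)

subsection \<open>Symmetry of second derivatives\<close>

text \<open>
  The second difference of \<open>f\<close> over a parallelogram with sides \<open>t u\<close> and \<open>t w\<close> equals \<open>t\<^sup>2\<close> times
  a mixed second derivative at some point of the parallelogram, by two applications of the mean
  value theorem.
\<close>

lemma second_difference:
  fixes f :: "'v::real_normed_vector \<Rightarrow> real"
  assumes S: "open S" and f: "Ck_on 2 S f" and t: "t > 0"
    and sub: "\<And>a b. 0 \<le> a \<Longrightarrow> a \<le> t \<Longrightarrow> 0 \<le> b \<Longrightarrow> b \<le> t \<Longrightarrow> x + a *\<^sub>R u + b *\<^sub>R w \<in> S"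
  shows "\<exists>a b. 0 < a \<and> a < t \<and> 0 < b \<and> b < t \<and>
    f (x + t *\<^sub>R u + t *\<^sub>R w) - f (x + t *\<^sub>R u) - f (x + t *\<^sub>R w) + f x =
    t * t * dir_deriv (\<lambda>y. dir_deriv f y u) (x + a *\<^sub>R u + b *\<^sub>R w) w"
proof -
  have f1: "f differentiable (at y)" "(\<lambda>y. dir_deriv f y u) differentiable (at y)" if "y \<in> S" for y
    using f that by (auto simp: numeral_2_eq_2)
  \<comment> \<open>The summand \<open>0 *\<^sub>R w\<close> makes both terms instances of one function of \<open>a\<close> and \<open>b\<close>.\<close>
  define g where "g a = f (x + a *\<^sub>R u + t *\<^sub>R w) - f (x + a *\<^sub>R u + 0 *\<^sub>R w)" for a
  have g: "(g has_real_derivative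
      dir_deriv f (x + a *\<^sub>R u + t *\<^sub>R w) u - dir_deriv f (x + a *\<^sub>R u + 0 *\<^sub>R w) u) (at a)"
    if a: "0 \<le> a" "a \<le> t" for a
  proof -
    have "((\<lambda>a. f (x + a *\<^sub>R u + b *\<^sub>R w)) has_real_derivative
        dir_deriv f (x + a *\<^sub>R u + b *\<^sub>R w) u) (at a)" if b: "0 \<le> b" "b \<le> t" for b
    proof -
      have "((\<lambda>a. x + a *\<^sub>R u + b *\<^sub>R w) has_derivative (\<lambda>h. h *\<^sub>R u)) (at a)"
        by (auto intro!: derivative_eq_intros)
      moreover have D: "(f has_derivative dir_deriv f (x + a *\<^sub>R u + b *\<^sub>R w)) (at (x + a *\<^sub>R u + b *\<^sub>R w))"
        using f1(1)[OF sub[OF a b]] frechet_derivative_works by blast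
      ultimately have "((\<lambda>a. f (x + a *\<^sub>R u + b *\<^sub>R w)) has_derivative
          (\<lambda>h. dir_deriv f (x + a *\<^sub>R u + b *\<^sub>R w) (h *\<^sub>R u))) (at a)"
        by (rule has_derivative_compose)
      then show ?thesis
        by (rule has_derivative_imp_has_field_derivative)
          (simp add: linear_scale[OF has_derivative_linear[OF D]])
    qed
    from DERIV_diff[OF this this, of t 0] t show ?thesis unfolding g_def by simp
  qed
  from MVT2[OF t g] obtain a where a: "0 < a" "a < t" and ga: "g t - g 0 =
      t * (dir_deriv f (x + a *\<^sub>R u + t *\<^sub>R w) u - dir_deriv f (x + a *\<^sub>R u + 0 *\<^sub>R w) u)"
    by auto
  define h where "h b = dir_deriv f (x + a *\<^sub>R u + b *\<^sub>R w) u" for b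
  have h: "(h has_real_derivative dir_deriv (\<lambda>y. dir_deriv f y u) (x + a *\<^sub>R u + b *\<^sub>R w) w) (at b)"
    if b: "0 \<le> b" "b \<le> t" for b
  proof -
    let ?y = "x + a *\<^sub>R u + b *\<^sub>R w"
    have "((\<lambda>b. x + a *\<^sub>R u + b *\<^sub>R w) has_derivative (\<lambda>h. h *\<^sub>R w)) (at b)"
      by (auto intro!: derivative_eq_intros)
    moreover have D: "((\<lambda>y. dir_deriv f y u) has_derivative dir_deriv (\<lambda>y. dir_deriv f y u) ?y) (at ?y)"
      using f1(2)[OF sub[OF _ _ b]] a frechet_derivative_works by force
    ultimately have "(h has_derivative (\<lambda>h. dir_deriv (\<lambda>y. dir_deriv f y u) ?y (h *\<^sub>R w))) (at b)"
      unfolding h_def by (rule has_derivative_compose)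
    then show ?thesis
      by (rule has_derivative_imp_has_field_derivative)
        (simp add: linear_scale[OF has_derivative_linear[OF D]])
  qed
  from MVT2[OF t h] obtain b where b: "0 < b" "b < t" and hb: "h t - h 0 =
      t * dir_deriv (\<lambda>y. dir_deriv f y u) (x + a *\<^sub>R u + b *\<^sub>R w) w"
    by auto
  have "f (x + t *\<^sub>R u + t *\<^sub>R w) - f (x + t *\<^sub>R u) - f (x + t *\<^sub>R w) + f x = g t - g 0"
    by (simp add: g_def)
  also have "\<dots> = t * (h t - h 0)" unfolding ga h_def ..
  also have "\<dots> = t * t * dir_deriv (\<lambda>y. dir_deriv f y u) (x + a *\<^sub>R u + b *\<^sub>R w) w"
    unfolding hb by simp
  finally show ?thesis using a b by blast
qed

text \<open>
  Both orders of differentiation compute the same second difference over arbitrarily small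
  parallelograms at \<open>x\<close>; continuity of the second derivatives identifies their values at \<open>x\<close>.
\<close>

lemma dir_deriv_commute:
  fixes f :: "'v::real_normed_vector \<Rightarrow> real"
  assumes S: "open S" and f: "Ck_on 2 S f" and x: "x \<in> S"
  shows "dir_deriv (\<lambda>y. dir_deriv f y u) x w = dir_deriv (\<lambda>y. dir_deriv f y w) x u"
proof (rule ccontr)
  define D where "D u w y = dir_deriv (\<lambda>y. dir_deriv f y u) y w" for u w y
  assume "\<not> ?thesis"
  then have e: "\<bar>D u w x - D w u x\<bar> / 2 > 0" (is "?e > 0") by (simp add: D_def)
  have "continuous_on S (D u w)" for u w
    using f by (simp add: numeral_2_eq_2 D_def[abs_def])
  then have "continuous (at x) (D u w)" "continuous (at x) (D w u)"
    using S x by (simp_all add: continuous_on_eq_continuous_at)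
  then obtain d1 d2 where d: "d1 > 0" "\<And>y. dist y x < d1 \<Longrightarrow> dist (D u w y) (D u w x) < ?e"
      "d2 > 0" "\<And>y. dist y x < d2 \<Longrightarrow> dist (D w u y) (D w u x) < ?e"
    using e unfolding continuous_at_eps_delta by (elim allE[of _ ?e]) blast
  from S x obtain d3 where d3: "d3 > 0" "ball x d3 \<subseteq> S" using open_contains_ball by blast
  define r where "r = min d1 (min d2 d3)"
  have r: "r > 0" "r \<le> d1" "r \<le> d2" "r \<le> d3" using d d3 by (auto simp: r_def)
  \<comment> \<open>Small enough for the parallelogram with sides \<open>t u\<close> and \<open>t w\<close> to lie in the ball of radius \<open>r\<close>.\<close>
  define t where "t = r / (norm u + norm w + 1)"
  have N: "norm u + norm w + 1 > 0" using norm_ge_zero[of u] norm_ge_zero[of w] by linarith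
  have t: "t > 0" unfolding t_def using r N by simp
  have near: "dist (x + a *\<^sub>R p + b *\<^sub>R q) x < r"
    if "0 \<le> a" "a \<le> t" "0 \<le> b" "b \<le> t" and pq: "norm p + norm q = norm u + norm w" for a b p q
  proof -
    have "dist (x + a *\<^sub>R p + b *\<^sub>R q) x = norm (a *\<^sub>R p + b *\<^sub>R q)" by (simp add: dist_norm add.assoc)
    also have "\<dots> \<le> a * norm p + b * norm q"
      using norm_triangle_ineq[of "a *\<^sub>R p" "b *\<^sub>R q"] that by simp
    also have "\<dots> \<le> t * norm p + t * norm q"
      using that by (intro add_mono mult_right_mono) auto
    also have "\<dots> = t * (norm u + norm w)" by (simp only: pq flip: distrib_left)
    also have "\<dots> < t * (norm u + norm w + 1)" using t by simp
    also have "\<dots> = r" using N by (simp add: t_def)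
    finally show ?thesis .
  qed
  have sub: "x + a *\<^sub>R p + b *\<^sub>R q \<in> S"
    if "0 \<le> a" "a \<le> t" "0 \<le> b" "b \<le> t" "norm p + norm q = norm u + norm w" for a b p q
    using near[OF that] d3 r by (auto simp: subset_eq dist_commute)
  obtain a b where ab: "0 < a" "a < t" "0 < b" "b < t"
    "f (x + t *\<^sub>R u + t *\<^sub>R w) - f (x + t *\<^sub>R u) - f (x + t *\<^sub>R w) + f x = t * t * D u w (x + a *\<^sub>R u + b *\<^sub>R w)"
    using second_difference[OF S f t, of x u w] sub unfolding D_def by blast
  obtain a' b' where ab': "0 < a'" "a' < t" "0 < b'" "b' < t"
    "f (x + t *\<^sub>R w + t *\<^sub>R u) - f (x + t *\<^sub>R w) - f (x + t *\<^sub>R u) + f x = t * t * D w u (x + a' *\<^sub>R w + b' *\<^sub>R u)"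
    using second_difference[OF S f t, of x w u] sub unfolding D_def by (metis add.commute)
  have "t * t * D u w (x + a *\<^sub>R u + b *\<^sub>R w) = t * t * D w u (x + a' *\<^sub>R w + b' *\<^sub>R u)"
    unfolding ab(5)[symmetric] ab'(5)[symmetric] by (simp add: algebra_simps)
  then have "D u w (x + a *\<^sub>R u + b *\<^sub>R w) = D w u (x + a' *\<^sub>R w + b' *\<^sub>R u)" using t by simp
  moreover have "dist (D u w (x + a *\<^sub>R u + b *\<^sub>R w)) (D u w x) < ?e"
    using near[of a b u w] ab r by (intro d(2)) auto
  moreover have "dist (D w u (x + a' *\<^sub>R w + b' *\<^sub>R u)) (D w u x) < ?e"
    using near[of a' b' w u] ab' r by (intro d(4)) auto
  ultimately show False by (auto simp: dist_real_def abs_if split: if_splits)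
qed

section \<open>Exterior derivative and Lie derivative in a chart\<close>

lemma ext_deriv_eq_alternation:
  "ext_deriv k \<alpha> C x = alternation k (\<lambda>u w. dir_deriv (\<lambda>y. \<alpha> C y w) x u)"
  by (simp add: fun_eq_iff ext_deriv_def alternation_def skip_def)

lemma dir_deriv_cong_open:
  assumes "open S" and "x \<in> S" and "f differentiable (at x)" and "\<And>y. y \<in> S \<Longrightarrow> f y = g y"
  shows "dir_deriv f x = dir_deriv g x"
  using frechet_derivative_transform_within_open[OF assms(3,1,2)] assms(4) by blast

text \<open>
  Smoothness of a form means smoothness on constant vectors. Expanding a variable argument in the
  standard basis reduces contraction with a vector field to this case.
\<close>

lemma contract_Basis:
  fixes u :: "'v::euclidean_space"
  assumes "alternating_form (Suc k) a"
  shows "a (case_nat u w) = (\<Sum>b\<in>Basis. (u \<bullet> b) * a (case_nat b w))"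
proof -
  have lin: "linear (\<lambda>u. a (case_nat u w))"
    using linear_contract[OF assms, of w] by (simp add: contract_def)
  have "a (case_nat (\<Sum>b\<in>Basis. (u \<bullet> b) *\<^sub>R b) w) = (\<Sum>b\<in>Basis. (u \<bullet> b) * a (case_nat b w))"
    by (simp add: linear_sum[OF lin] linear_scale[OF lin])
  then show ?thesis by (simp add: euclidean_representation)
qed

lemma Ck_on_contract:
  fixes a :: "'v::euclidean_space \<Rightarrow> 'v covec"
  assumes S: "open S" and alt: "\<And>y. y \<in> S \<Longrightarrow> alternating_form (Suc k) (a y)"
    and a: "\<And>w. Ck_on m S (\<lambda>y. a y w)" and X: "Ck_on m S X"
  shows "Ck_on m S (\<lambda>y. contract (X y) (a y) w)"
proof (rule Ck_on_cong[OF S])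
  show "Ck_on m S (\<lambda>y. \<Sum>b\<in>Basis. (X y \<bullet> b) * a y (case_nat b w))"
    by (intro Ck_on_sum Ck_on_mult Ck_on_inner S X a)
qed (use contract_Basis[OF alt] in \<open>simp add: contract_def\<close>)

lemma dir_deriv_contract:
  fixes a :: "'v::euclidean_space \<Rightarrow> 'v covec"
  assumes S: "open S" "x \<in> S" and alt: "\<And>y. y \<in> S \<Longrightarrow> alternating_form (Suc k) (a y)"
    and a: "\<And>w. (\<lambda>y. a y w) differentiable (at x)" and X: "X differentiable (at x)"
  shows "dir_deriv (\<lambda>y. contract (X y) (a y) w) x u
    = dir_deriv (\<lambda>y. a y (case_nat (X x) w)) x u + a x (case_nat (dir_deriv X x u) w)"
proof -
  have Xb: "(\<lambda>y. X y \<bullet> b) differentiable (at x)" for b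
    by (rule differentiable_inner_const[OF X])
  have "dir_deriv (\<lambda>y. \<Sum>b\<in>Basis. (X y \<bullet> b) * a y (case_nat b w)) x = dir_deriv (\<lambda>y. contract (X y) (a y) w) x"
    by (rule dir_deriv_cong_open[OF S])
      (use contract_Basis[OF alt] in \<open>auto simp: contract_def intro!: differentiable_sum differentiable_mult Xb a\<close>)
  then have "dir_deriv (\<lambda>y. contract (X y) (a y) w) x u
      = dir_deriv (\<lambda>y. \<Sum>b\<in>Basis. (X y \<bullet> b) * a y (case_nat b w)) x u" by simp
  also have "\<dots> = (\<Sum>b\<in>Basis. dir_deriv (\<lambda>y. (X y \<bullet> b) * a y (case_nat b w)) x u)"
    by (intro dir_deriv_sum differentiable_mult Xb a)
  also have "\<dots> = (\<Sum>b\<in>Basis. (X x \<bullet> b) * dir_deriv (\<lambda>y. a y (case_nat b w)) x u)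
      + (\<Sum>b\<in>Basis. (dir_deriv X x u \<bullet> b) * a x (case_nat b w))"
    by (simp only: dir_deriv_mult[OF Xb a] dir_deriv_inner[OF X] sum.distrib add.commute)
  also have "(\<Sum>b\<in>Basis. (dir_deriv X x u \<bullet> b) * a x (case_nat b w)) = a x (case_nat (dir_deriv X x u) w)"
    by (rule contract_Basis[OF alt[OF S(2)], symmetric])
  also have "(\<Sum>b\<in>Basis. (X x \<bullet> b) * dir_deriv (\<lambda>y. a y (case_nat b w)) x u)
      = dir_deriv (\<lambda>y. \<Sum>b\<in>Basis. (X x \<bullet> b) * a y (case_nat b w)) x u"
    by (subst dir_deriv_sum) (auto intro!: differentiable_mult a simp: dir_deriv_cmult[OF a])
  also have "dir_deriv (\<lambda>y. \<Sum>b\<in>Basis. (X x \<bullet> b) * a y (case_nat b w)) x = dir_deriv (\<lambda>y. a y (case_nat (X x) w)) x"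
    by (rule dir_deriv_cong_open[OF S])
      (auto intro!: differentiable_sum differentiable_mult a simp: contract_Basis[OF alt, of _ "X x"])
  finally show ?thesis .
qed

text \<open>
  Cartan's formula. The terms \<open>\<alpha>(X, \<dots>)\<close> differentiated in \<open>\<alpha>\<close> cancel between the two summands on the
  right; the derivatives of \<open>X\<close> come from \<open>d i\<^sub>X\<close> only and give the bracket terms of the Lie derivative.
\<close>

lemma lie_deriv_Cartan:
  fixes X :: "'a vfield" and \<alpha> :: "'a dform"
  assumes S: "open S" "x \<in> S" and alt: "\<And>y. y \<in> S \<Longrightarrow> alternating_form (Suc k) (\<alpha> C y)"
    and a: "\<And>w. (\<lambda>y. \<alpha> C y w) differentiable (at x)" and X: "X C differentiable (at x)"
  shows "lie_deriv (Suc k) X \<alpha> C x v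
    = ext_deriv k (form_contract X \<alpha>) C x v + contract (X C x) (ext_deriv (Suc k) \<alpha> C x) v"
proof -
  let ?D = "\<lambda>u w. \<alpha> C x (case_nat (dir_deriv (X C) x u) w)"
  have lin: "linear (\<lambda>u. \<alpha> C x (v(i := u)))" if "i \<le> k" for i
    using that alternating_form_linear[OF alt[OF S(2)]] by simp
  have D: "dir_deriv (\<lambda>y. contract (X C y) (\<alpha> C y) w) x u
      = dir_deriv (\<lambda>y. \<alpha> C y (case_nat (X C x) w)) x u + ?D u w" for u w
    by (rule dir_deriv_contract[OF S alt a X])
  have "ext_deriv k (form_contract X \<alpha>) C x v
      = alternation k (\<lambda>u w. dir_deriv (\<lambda>y. \<alpha> C y (case_nat (X C x) w)) x u) v + alternation k ?D v"
    by (simp only: ext_deriv_eq_alternation form_contract_def D alternation_add)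
  moreover have "contract (X C x) (ext_deriv (Suc k) \<alpha> C x) v = dir_deriv (\<lambda>y. \<alpha> C y v) x (X C x)
      - alternation k (\<lambda>u w. dir_deriv (\<lambda>y. \<alpha> C y (case_nat (X C x) w)) x u) v"
    unfolding contract_def ext_deriv_eq_alternation alternation_case_nat ..
  moreover have "alternation k ?D v
      = - (\<Sum>i<Suc k. \<alpha> C x (v(i := lie_bracket (X C) (\<lambda>_. v i) x)))"
    unfolding alternation_def sum_negf[symmetric] lessThan_Suc_atMost
    by (intro sum.cong refl)
      (simp add: lie_bracket_def linear_neg[OF lin] alternating_form_front[OF alt[OF S(2)]]
        flip: power_add mult.assoc)
  ultimately show ?thesis by (simp add: lie_deriv_def)
qed

section \<open>The twisted derivative\<close>

text \<open>
  \<open>d\<^sub>\<theta>\<close> is the exterior derivative of the connection \<open>\<nabla>\<^sub>u = \<partial>\<^sub>u + \<theta>(u)\<close> on the trivial line bundle.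
\<close>

lemma twisted_deriv_eq_alternation:
  assumes "alternating_form 1 (\<theta> C x)" and "alternating_form k (\<alpha> C x)"
  shows "twisted_deriv k \<theta> \<alpha> C x
    = alternation k (\<lambda>u w. dir_deriv (\<lambda>y. \<alpha> C y w) x u + \<theta> C x (\<lambda>_. u) * \<alpha> C x w)"
  by (simp add: fun_eq_iff twisted_deriv_def form_wedge_def ext_deriv_eq_alternation
      wedge_1_eq_alternation[OF assms] alternation_add del: One_nat_def)

lemma dir_deriv_alternation:
  assumes "\<And>u w. (\<lambda>y. T y u w) differentiable (at x)"
  shows "dir_deriv (\<lambda>y. alternation k (T y) v) x u = alternation k (\<lambda>u' w. dir_deriv (\<lambda>y. T y u' w) x u) v"
  unfolding alternation_def
  by (subst dir_deriv_sum) (auto simp: dir_deriv_cmult assms intro!: differentiable_mult)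

text \<open>Evaluate \<open>d\<theta> = 0\<close> at \<open>(u, w)\<close>.\<close>

lemma closed_1_form_symmetric:
  assumes S: "open S" "x \<in> S" and alt: "\<And>y. y \<in> S \<Longrightarrow> alternating_form 1 (\<theta> C y)"
    and diff: "\<And>w. (\<lambda>y. \<theta> C y w) differentiable (at x)"
    and closed: "\<And>v. ext_deriv 1 \<theta> C x v = 0"
  shows "dir_deriv (\<lambda>y. \<theta> C y (\<lambda>_. w)) x u = dir_deriv (\<lambda>y. \<theta> C y (\<lambda>_. u)) x w"
proof -
  define v where "v = case_nat u (\<lambda>_. w)"
  have "dir_deriv (\<lambda>y. \<theta> C y (\<lambda>j. v (skip i j))) x = dir_deriv (\<lambda>y. \<theta> C y (\<lambda>_. v (skip i 0))) x" for i
    by (rule dir_deriv_cong_open[OF S diff]) (rule alternating_form_1[OF alt])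
  then have "ext_deriv 1 \<theta> C x v = (\<Sum>i\<le>1. (- 1) ^ i * dir_deriv (\<lambda>y. \<theta> C y (\<lambda>_. v (skip i 0))) x (v i))"
    by (simp only: ext_deriv_eq_alternation alternation_def)
  then show ?thesis
    using closed[of v] by (simp add: v_def skip_def)
qed

text \<open>
  For closed \<open>\<theta>\<close> the connection is flat, that is \<open>\<nabla>\<^sub>u \<nabla>\<^sub>w \<alpha>\<close> is symmetric in the constant vectors \<open>u\<close>
  and \<open>w\<close>; hence \<open>d\<^sub>\<theta> d\<^sub>\<theta> = 0\<close>.
\<close>

lemma twisted_deriv_twisted_deriv:
  fixes \<alpha> \<theta> :: "'a dform"
  assumes S: "open S" "x \<in> S"
    and alt\<theta>: "\<And>y. y \<in> S \<Longrightarrow> alternating_form 1 (\<theta> C y)"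
    and \<theta>: "\<And>w. (\<lambda>y. \<theta> C y w) differentiable (at x)"
    and closed: "\<And>v. ext_deriv 1 \<theta> C x v = 0"
    and alt\<alpha>: "\<And>y. y \<in> S \<Longrightarrow> alternating_form k (\<alpha> C y)"
    and \<alpha>: "\<And>w. Ck_on 2 S (\<lambda>y. \<alpha> C y w)"
    and \<beta>: "\<And>y w. y \<in> S \<Longrightarrow> \<beta> y w = twisted_deriv k \<theta> \<alpha> C y w"
  shows "alternation (Suc k) (\<lambda>u w. dir_deriv (\<lambda>y. \<beta> y w) x u + \<theta> C x (\<lambda>_. u) * \<beta> x w) v = 0"
proof -
  define conn where "conn y u w = dir_deriv (\<lambda>y. \<alpha> C y w) y u + \<theta> C y (\<lambda>_. u) * \<alpha> C y w" for y u w
  have \<beta>': "\<beta> y = alternation k (conn y)" if "y \<in> S" for y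
    using \<beta>[OF that] twisted_deriv_eq_alternation[of \<theta> C y k \<alpha>, OF alt\<theta>[OF that] alt\<alpha>[OF that]]
    by (simp add: fun_eq_iff conn_def[abs_def])
  have d\<alpha>: "(\<lambda>y. \<alpha> C y w) differentiable (at x)"
      "(\<lambda>y. dir_deriv (\<lambda>y. \<alpha> C y w) y u) differentiable (at x)" for u w
    using \<alpha>[of w] S by (simp_all add: numeral_2_eq_2)
  have dconn: "(\<lambda>y. conn y u w) differentiable (at x)" for u w
    unfolding conn_def by (intro differentiable_add differentiable_mult d\<alpha> \<theta>)
  have d\<beta>: "dir_deriv (\<lambda>y. \<beta> y w) x u = alternation k (\<lambda>u' w. dir_deriv (\<lambda>y. conn y u' w) x u) w" for u w
  proof -
    have "(\<lambda>y. alternation k (conn y) w) differentiable (at x)"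
      unfolding alternation_def
      by (intro differentiable_sum ballI differentiable_mult dconn differentiable_const) simp
    then have "dir_deriv (\<lambda>y. alternation k (conn y) w) x = dir_deriv (\<lambda>y. \<beta> y w) x"
      by (rule dir_deriv_cong_open[OF S]) (simp add: \<beta>')
    then have "dir_deriv (\<lambda>y. \<beta> y w) x u = dir_deriv (\<lambda>y. alternation k (conn y) w) x u" by simp
    also have "\<dots> = alternation k (\<lambda>u' w. dir_deriv (\<lambda>y. conn y u' w) x u) w"
      by (rule dir_deriv_alternation[OF dconn])
    finally show ?thesis .
  qed
  have dconn': "dir_deriv (\<lambda>y. conn y u' w) x u = dir_deriv (\<lambda>y. dir_deriv (\<lambda>y. \<alpha> C y w) y u') x u
      + dir_deriv (\<lambda>y. \<theta> C y (\<lambda>_. u')) x u * \<alpha> C x w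
      + \<theta> C x (\<lambda>_. u') * dir_deriv (\<lambda>y. \<alpha> C y w) x u" for u u' w
    unfolding conn_def by (simp add: dir_deriv_add dir_deriv_mult d\<alpha> \<theta> differentiable_mult)
  have "dir_deriv (\<lambda>y. \<beta> y w) x u + \<theta> C x (\<lambda>_. u) * \<beta> x w
      = alternation k (\<lambda>u' w. dir_deriv (\<lambda>y. conn y u' w) x u + \<theta> C x (\<lambda>_. u) * conn x u' w) w" for u w
    by (simp add: d\<beta> \<beta>'[OF S(2)] alternation_add alternation_mult)
  moreover have "alternation (Suc k) (\<lambda>u. alternation k
      (\<lambda>u' w. dir_deriv (\<lambda>y. conn y u' w) x u + \<theta> C x (\<lambda>_. u) * conn x u' w)) v = 0"
  proof (rule alternation_alternation_symmetric)
    fix u u' w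
    have "dir_deriv (\<lambda>y. dir_deriv (\<lambda>y. \<alpha> C y w) y u') x u
        = dir_deriv (\<lambda>y. dir_deriv (\<lambda>y. \<alpha> C y w) y u) x u'"
      by (rule dir_deriv_commute[OF S(1) \<alpha> S(2)])
    moreover have "dir_deriv (\<lambda>y. \<theta> C y (\<lambda>_. u')) x u = dir_deriv (\<lambda>y. \<theta> C y (\<lambda>_. u)) x u'"
      by (rule closed_1_form_symmetric[OF S alt\<theta> \<theta> closed])
    ultimately show "dir_deriv (\<lambda>y. conn y u' w) x u + \<theta> C x (\<lambda>_. u) * conn x u' w
        = dir_deriv (\<lambda>y. conn y u w) x u' + \<theta> C x (\<lambda>_. u') * conn x u w"
      unfolding dconn' by (simp add: conn_def algebra_simps)
  qed
  ultimately show ?thesis by simp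
qed

section \<open>Forms with constant coefficients in a coframe\<close>

text \<open>
  The index list \<open>[i, j, \<dots>]\<close> denotes \<open>e\<^sup>i \<and> (e\<^sup>j \<and> \<dots>)\<close>, and a list of pairs of coefficients and index
  lists denotes a linear combination. In this form products and normal forms are computable.
\<close>

primrec monomial :: "(nat \<Rightarrow> 'v covec) \<Rightarrow> nat list \<Rightarrow> 'v covec" where
  "monomial e [] = (\<lambda>v. 1)"
| "monomial e (i # is) = wedge 1 (length is) (e i) (monomial e is)"

type_synonym ext_poly = "(int \<times> nat list) list"

definition const_form :: "(nat \<Rightarrow> 'v covec) \<Rightarrow> ext_poly \<Rightarrow> 'v covec" where
  "const_form e L v = (\<Sum>(c, is)\<leftarrow>L. of_int c * monomial e is v)"

definition ext_mult :: "ext_poly \<Rightarrow> ext_poly \<Rightarrow> ext_poly" where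
  "ext_mult L L' = concat (map (\<lambda>(c, is). map (\<lambda>(d, js). (c * d, is @ js)) L') L)"

text \<open>
  Insertion sort with the sign of the transpositions performed. The sign \<open>0\<close> records a repeated
  index, which makes the monomial vanish.
\<close>

fun sign_insert :: "nat \<Rightarrow> nat list \<Rightarrow> int \<times> nat list" where
  "sign_insert i [] = (1, [i])"
| "sign_insert i (j # js) =
    (if i < j then (1, i # j # js)
     else if i = j then (0, i # j # js)
     else case sign_insert i js of (s, r) \<Rightarrow> (- s, j # r))"

fun sign_sort :: "nat list \<Rightarrow> int \<times> nat list" where
  "sign_sort [] = (1, [])"
| "sign_sort (i # is) =
    (case sign_sort is of (s, r) \<Rightarrow> case sign_insert i r of (t, q) \<Rightarrow> (s * t, q))"

definition phi :: ext_poly where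
  "phi = [(1, [1, 2, 7]), (1, [3, 4, 7]), (1, [5, 6, 7]), (1, [1, 3, 5]),
          (-1, [1, 4, 6]), (-1, [2, 3, 6]), (-1, [2, 4, 5])]"

text \<open>
  The coefficient of \<open>e\<^sup>p(x)\<close> in \<open>i\<^sub>x \<phi>\<close>. Only moving the middle index of a triple to the front costs a sign.
\<close>

definition contract_phi :: "nat \<Rightarrow> ext_poly" where
  "contract_phi p = concat (map (\<lambda>(c, is).
     if is ! 0 = p then [(c, [is ! 1, is ! 2])]
     else if is ! 1 = p then [(- c, [is ! 0, is ! 2])]
     else if is ! 2 = p then [(c, [is ! 0, is ! 1])]
     else []) phi)"

text \<open>\<open>L\<close> reduces to \<open>t\<close> times \<open>e\<^sup>1\<^sup>2\<^sup>3\<^sup>4\<^sup>5\<^sup>6\<^sup>7\<close> by sorting its monomials.\<close>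

definition is_top :: "int \<Rightarrow> ext_poly \<Rightarrow> bool" where
  "is_top t L \<longleftrightarrow> list_all (\<lambda>(c, is). fst (sign_sort is) = 0 \<or> snd (sign_sort is) = [1, 2, 3, 4, 5, 6, 7]) L \<and>
     (\<Sum>(c, is)\<leftarrow>L. c * fst (sign_sort is)) = t"

text \<open>
  The coefficients of \<open>i\<^sub>x \<phi> \<and> i\<^sub>y \<phi> \<and> \<phi>\<close>, the reason for the factor \<open>1/6\<close> in the definition of the metric.
  For \<open>p = q = 7\<close>, say, the form \<open>\<kappa> = e\<^sup>1\<^sup>2 + e\<^sup>3\<^sup>4 + e\<^sup>5\<^sup>6\<close> is the contraction and
  \<open>\<kappa> \<and> \<kappa> \<and> \<phi> = \<kappa>\<^sup>3 \<and> e\<^sup>7 = 6 e\<^sup>1\<^sup>2\<^sup>3\<^sup>4\<^sup>5\<^sup>6\<^sup>7\<close>; the other pairs are a finite computation.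
\<close>

lemma g2_top_form:
  "list_all (\<lambda>p. list_all (\<lambda>q. is_top (if p = q then 6 else 0)
     (ext_mult (contract_phi p) (ext_mult (contract_phi q) phi))) [1, 2, 3, 4, 5, 6, 7]) [1, 2, 3, 4, 5, 6, 7]"
  by code_simp

subsection \<open>Monomials as forms\<close>

lemma wedge_linear_left: "wedge k l (\<lambda>v. c * a v + a' v) b = (\<lambda>v. c * wedge k l a b v + wedge k l a' b v)"
  by (simp add: fun_eq_iff wedge_def sum.distrib[symmetric] sum_distrib_left add_divide_distrib[symmetric] algebra_simps)

lemma wedge_linear_right: "wedge k l a (\<lambda>v. c * b v + b' v) = (\<lambda>v. c * wedge k l a b v + wedge k l a b' v)"
  by (simp add: fun_eq_iff wedge_def sum.distrib[symmetric] sum_distrib_left add_divide_distrib[symmetric] algebra_simps)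

lemma wedge_0_left [simp]: "wedge k l (\<lambda>v. 0) b = (\<lambda>v. 0)"
  by (simp add: fun_eq_iff wedge_def)

lemma wedge_0_right [simp]: "wedge k l a (\<lambda>v. 0) = (\<lambda>v. 0)"
  by (simp add: fun_eq_iff wedge_def)

lemma wedge_mult_right: "wedge k l a (\<lambda>v. c * b v) = (\<lambda>v. c * wedge k l a b v)"
  using wedge_linear_right[of k l a c b "\<lambda>_. 0"] by simp

lemma wedge_sum_left:
  "wedge k l (\<lambda>v. \<Sum>i\<in>I. c i * a i v) b = (\<lambda>v. \<Sum>i\<in>I. c i * wedge k l (a i) b v)"
  by (induction I rule: infinite_finite_induct) (simp_all add: wedge_linear_left)

lemma wedge_sum_right:
  "wedge k l a (\<lambda>v. \<Sum>i\<in>I. c i * b i v) = (\<lambda>v. \<Sum>i\<in>I. c i * wedge k l a (b i) v)"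
  by (induction I rule: infinite_finite_induct) (simp_all add: wedge_linear_right)

lemma const_form_Nil [simp]: "const_form e [] = (\<lambda>v. 0)"
  by (simp add: fun_eq_iff const_form_def)

lemma const_form_Cons: "const_form e ((c, is) # L) = (\<lambda>v. of_int c * monomial e is v + const_form e L v)"
  by (simp add: fun_eq_iff const_form_def)

lemma const_form_append: "const_form e (L @ L') v = const_form e L v + const_form e L' v"
  by (simp add: const_form_def)

context
  fixes e :: "nat \<Rightarrow> 'v::real_vector covec"
  assumes e: "\<And>i. alternating_form 1 (e i)"
begin

lemma alternating_form_monomial: "alternating_form (length is) (monomial e is)"
proof (induction "is")
  case Nil
  show ?case by (simp add: alternating_form_def)
next
  case (Cons i "is")
  then show ?case using alternating_form_wedge_1[OF e] by simp
qed

lemma monomial_single: "monomial e [i] = e i"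
proof
  fix v
  have "alternating_form 0 (\<lambda>_ :: nat \<Rightarrow> 'v. 1)" by (simp add: alternating_form_def)
  from wedge_1_eq_alternation[OF e this] show "monomial e [i] v = e i v"
    using alternating_form_1[OF e, of i v] by (simp add: alternation_def)
qed

lemma monomial_pair: "monomial e [i, j] u = e i (\<lambda>_. u 0) * e j (\<lambda>_. u 1) - e i (\<lambda>_. u 1) * e j (\<lambda>_. u 0)"
  using wedge_1_1[OF e[of i] e[of j], of u] monomial_single[of j] by simp

lemma e3_eq_monomial: "e3 e i j k = monomial e [i, j, k]"
  using monomial_single[of k] by (simp add: e3_def numeral_2_eq_2)

lemma monomial_triple: "monomial e [i, j, k] u =
    e i (\<lambda>_. u 0) * (e j (\<lambda>_. u 1) * e k (\<lambda>_. u 2) - e j (\<lambda>_. u 2) * e k (\<lambda>_. u 1))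
  - e i (\<lambda>_. u 1) * (e j (\<lambda>_. u 0) * e k (\<lambda>_. u 2) - e j (\<lambda>_. u 2) * e k (\<lambda>_. u 0))
  + e i (\<lambda>_. u 2) * (e j (\<lambda>_. u 0) * e k (\<lambda>_. u 1) - e j (\<lambda>_. u 1) * e k (\<lambda>_. u 0))"
proof -
  have "monomial e [i, j, k] u = alternation 2 (\<lambda>x w. e i (\<lambda>_. x) * monomial e [j, k] w) u"
    using wedge_1_eq_alternation[OF e[of i] alternating_form_monomial[of "[j, k]"]]
    by (simp add: numeral_2_eq_2)
  then show ?thesis
    unfolding alternation_def monomial_pair by (simp add: numeral_2_eq_2 skip_def)
qed

text \<open>
  Iterating the expansion along the value at \<open>0\<close> gives the Leibniz formula. The bijection \<open>h\<close>
  translates between numbered arguments and the index type of a square matrix.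
\<close>

lemma monomial_eq_det:
  fixes h :: "'n::finite \<Rightarrow> nat"
  assumes h: "bij_betw h UNIV {..<length is}"
  shows "monomial e is v = det (\<chi> r s. e (is ! h r) (\<lambda>_. v (h s)))"
proof -
  have leibniz: "monomial e is v = (\<Sum>\<sigma> | \<sigma> permutes {..<length is}.
      of_int (sign \<sigma>) * (\<Prod>m<length is. e (is ! m) (\<lambda>_. v (\<sigma> m))))" for v
  proof (induction "is" arbitrary: v)
    case Nil
    have "{\<sigma>. \<sigma> permutes ({} :: nat set)} = {id}" by (auto simp: id_def)
    then show ?case by (simp add: sign_id)
  next
    case (Cons i "is")
    have "monomial e (i # is) v = (\<Sum>r\<le>length is. (- 1) ^ r * (e i (\<lambda>_. v r) * monomial e is (\<lambda>j. v (skip r j))))"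
      using wedge_1_eq_alternation[OF e[of i] alternating_form_monomial[of "is"]] by (simp add: alternation_def)
    also have "\<dots> = (\<Sum>\<sigma> | \<sigma> permutes {..<Suc (length is)}.
        of_int (sign \<sigma>) * (\<Prod>m<Suc (length is). e ((i # is) ! m) (\<lambda>_. v (\<sigma> m))))"
      unfolding sum_permutes_lessThan_Suc Cons.IH
      by (intro sum.cong refl)
        (simp add: prod.lessThan_Suc_shift sum_distrib_left mult_ac del: prod.lessThan_Suc)
    finally show ?case by simp
  qed
  have hinj: "inj h" and hUNIV: "h s < length is" for s
    using h by (auto simp: bij_betw_def)
  let ?g = "inv_into UNIV h"
  have "monomial e is v = (\<Sum>p | p permutes (UNIV :: 'n set).
      of_int (sign p) * (\<Prod>r\<in>UNIV. e (is ! h r) (\<lambda>_. v (h (p r)))))"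
    unfolding leibniz
  proof (rule sum.reindex_bij_witness[of _ "map_permutation UNIV h" "map_permutation {..<length is} ?g"])
    fix \<sigma> assume "\<sigma> \<in> {\<sigma>. \<sigma> permutes {..<length is}}"
    then have \<sigma>: "\<sigma> permutes {..<length is}" by simp
    have g: "bij_betw ?g {..<length is} UNIV" by (rule bij_betw_inv_into[OF h])
    let ?p = "map_permutation {..<length is} ?g \<sigma>"
    show p: "?p \<in> {p. p permutes UNIV}"
      using map_permutation_permutes[OF g \<sigma>] by simp
    show h_inv: "map_permutation UNIV h ?p = \<sigma>"
      by (rule map_permutation_compose_inv[OF g \<sigma>]) (use bij_betw_inv_into_right[OF h] in auto)
    have "sign \<sigma> = sign ?p"
      using sign_map_permutation[OF hinj, of ?p] p h_inv by simp
    moreover have "\<sigma> (h r) = h (?p r)" for r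
      using map_permutation_apply[OF hinj, of r ?p] h_inv by simp
    then have "(\<Prod>r\<in>UNIV. e (is ! h r) (\<lambda>_. v (h (?p r)))) = (\<Prod>r\<in>UNIV. e (is ! h r) (\<lambda>_. v (\<sigma> (h r))))"
      by simp
    ultimately show "of_int (sign ?p) * (\<Prod>r\<in>UNIV. e (is ! h r) (\<lambda>_. v (h (?p r))))
        = (of_int (sign \<sigma>) * (\<Prod>m<length is. e (is ! m) (\<lambda>_. v (\<sigma> m))) :: real)"
      using prod.reindex_bij_betw[OF h, of "\<lambda>m. e (is ! m) (\<lambda>_. v (\<sigma> m))"] by simp
  next
    fix p assume "p \<in> {p. p permutes (UNIV :: 'n set)}"
    then have p: "p permutes UNIV" by simp
    show "map_permutation UNIV h p \<in> {\<sigma>. \<sigma> permutes {..<length is}}"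
      using map_permutation_permutes[OF h p] by simp
    show "map_permutation {..<length is} ?g (map_permutation UNIV h p) = p"
      by (rule map_permutation_compose_inv[OF h p]) (use hinj in auto)
  qed
  then show ?thesis by (simp add: det_def)
qed

subsection \<open>Sorting monomials\<close>

lemma monomial_sign_insert:
  "length (snd (sign_insert i js)) = Suc (length js) \<and>
   monomial e (i # js) = (\<lambda>v. of_int (fst (sign_insert i js)) * monomial e (snd (sign_insert i js)) v)"
proof (induction js)
  case (Cons j js)
  obtain s r where sr: "sign_insert i js = (s, r)" by fastforce
  consider "i < j" | "i = j" | "j < i" by linarith
  then show ?case
  proof cases
    case 2
    then show ?thesis using wedge_1_idem[OF e[of j] alternating_form_monomial[of js]] by (simp add: fun_eq_iff)
  next
    case 3
    have IH: "length r = Suc (length js)" "monomial e (i # js) = (\<lambda>v. of_int s * monomial e r v)"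
      using Cons.IH sr by simp_all
    have "monomial e (i # j # js) v = - of_int s * monomial e (j # r) v" for v
    proof -
      have "monomial e (i # j # js) v = - wedge 1 (Suc (length js)) (e j) (monomial e (i # js)) v"
        using wedge_1_anticommute[OF e[of i] e[of j] alternating_form_monomial[of js], of v] by simp
      also have "\<dots> = - of_int s * monomial e (j # r) v"
        unfolding IH(2) wedge_mult_right by (simp add: IH(1))
      finally show ?thesis .
    qed
    then show ?thesis using 3 sr IH(1) by (simp add: fun_eq_iff)
  qed simp
qed (simp add: fun_eq_iff)

lemma monomial_sign_sort:
  "length (snd (sign_sort is)) = length is \<and>
   monomial e is = (\<lambda>v. of_int (fst (sign_sort is)) * monomial e (snd (sign_sort is)) v)"
proof (induction "is")
  case (Cons i "is")
  obtain s r where sr: "sign_sort is = (s, r)" by fastforce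
  obtain t q where tq: "sign_insert i r = (t, q)" by fastforce
  have IH: "length r = length is" "monomial e is = (\<lambda>v. of_int s * monomial e r v)"
    using Cons.IH sr by simp_all
  have "monomial e (i # is) v = of_int s * monomial e (i # r) v" for v
    by (simp only: monomial.simps IH wedge_mult_right)
  then show ?case
    using monomial_sign_insert[of i r] IH(1) by (simp add: fun_eq_iff sr tq)
qed (simp add: fun_eq_iff)

lemma const_form_top:
  assumes "is_top t L"
  shows "const_form e L v = of_int t * monomial e [1, 2, 3, 4, 5, 6, 7] v"
proof -
  let ?top = "monomial e [1, 2, 3, 4, 5, 6, 7] v"
  have L: "fst (sign_sort is) = 0 \<or> snd (sign_sort is) = [1, 2, 3, 4, 5, 6, 7]" if "(c, is) \<in> set L" for c "is"
    using assms that by (auto simp: is_top_def list_all_iff)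
  have "of_int c * monomial e is v = of_int (c * fst (sign_sort is)) * ?top" if "(c, is) \<in> set L" for c "is"
    using L[OF that] fun_cong[OF conjunct2[OF monomial_sign_sort[of "is"]], of v] by auto
  then have "const_form e L v = (\<Sum>(c, is)\<leftarrow>L. of_int (c * fst (sign_sort is)) * ?top)"
    unfolding const_form_def by (intro arg_cong[where f = sum_list] map_cong) auto
  also have "\<dots> = of_int (\<Sum>(c, is)\<leftarrow>L. c * fst (sign_sort is)) * ?top"
    by (induction L) (auto simp: algebra_simps)
  also have "(\<Sum>(c, is)\<leftarrow>L. c * fst (sign_sort is)) = t"
    using assms by (simp add: is_top_def)
  finally show ?thesis .
qed

lemma wedge_2_monomial:
  "wedge 2 (length js) (monomial e [i, j]) (monomial e js) = monomial e (i # j # js)"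
  using wedge_2_wedge_1[OF e[of i] e[of j] alternating_form_monomial[of js]] monomial_single[of j] by simp

lemma wedge_2_const_form:
  assumes L: "\<And>c is. (c, is) \<in> set L \<Longrightarrow> length is = 2"
    and L': "\<And>c is. (c, is) \<in> set L' \<Longrightarrow> length is = l"
  shows "wedge 2 l (const_form e L) (const_form e L') = const_form e (ext_mult L L')"
  using L
proof (induction L)
  case Nil
  then show ?case by (simp add: ext_mult_def)
next
  case (Cons x L)
  obtain c "is" where "x = (c, is)" by fastforce
  moreover from this have "length is = 2" using Cons.prems[of c "is"] by simp
  ultimately obtain i j where x: "x = (c, [i, j])"
    by (auto simp: numeral_2_eq_2 length_Suc_conv)
  have "wedge 2 l (monomial e [i, j]) (const_form e L') = const_form e (map (\<lambda>(d, js). (d, i # j # js)) L')"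
    using L'
  proof (induction L')
    case (Cons y L')
    obtain d js where y: "y = (d, js)" by fastforce
    moreover from this have "length js = l" using Cons.prems[of d js] by simp
    moreover have "wedge 2 l (monomial e [i, j]) (const_form e L') = const_form e (map (\<lambda>(d, js). (d, i # j # js)) L')"
      using Cons.prems by (intro Cons.IH) (meson list.set_intros(2))
    ultimately show ?case
      using wedge_2_monomial[of js i j] by (simp add: const_form_Cons wedge_linear_right del: monomial.simps)
  qed simp
  moreover have "const_form e (map (\<lambda>(d, js). (c * d, i # j # js)) L') v
      = of_int c * const_form e (map (\<lambda>(d, js). (d, i # j # js)) L') v" for v
    by (induction L') (auto simp: const_form_Cons algebra_simps)
  moreover have "wedge 2 l (const_form e L) (const_form e L') = const_form e (ext_mult L L')"
    using Cons.prems by (intro Cons.IH) (meson list.set_intros(2))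
  ultimately show ?case
    by (simp add: x const_form_Cons wedge_linear_left ext_mult_def const_form_append fun_eq_iff del: monomial.simps)
qed

lemma contract_const_form_phi:
  "contract x (const_form e phi) = (\<lambda>v. \<Sum>p=1..7. e p (\<lambda>_. x) * const_form e (contract_phi p) v)"
proof
  fix v
  have 7: "{1..7::nat} = {1, 2, 3, 4, 5, 6, 7}" by auto
  show "contract x (const_form e phi) v = (\<Sum>p=1..7. e p (\<lambda>_. x) * const_form e (contract_phi p) v)"
    unfolding contract_def 7
    by (simp add: phi_def contract_phi_def const_form_Cons monomial_triple monomial_pair numeral_2_eq_2 algebra_simps del: monomial.simps)
qed

end

lemma alternating_form_const_form:
  assumes e: "\<And>i. alternating_form 1 (e i)" and "\<forall>(c, is) \<in> set L. length is = k"
  shows "alternating_form k (const_form e L)"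
  using assms(2)
proof (induction L)
  case (Cons y L)
  obtain c "is" where y: "y = (c, is)" by fastforce
  have "alternating_form k (monomial e is)"
    using alternating_form_monomial[of e "is", OF e] Cons.prems y by simp
  then show ?case
    using Cons unfolding y const_form_Cons by (intro alternating_form_add alternating_form_mult) auto
qed (simp add: alternating_form_0)

section \<open>Linear algebra of a \<open>G\<^sub>2\<close>-form\<close>

text \<open>
  Independence of the seven 1-forms says that no hyperplane contains the image of
  \<open>x \<mapsto> (e\<^sup>1(x), \<dots>, e\<^sup>7(x))\<close>; this map is therefore onto, and bijective for reasons of dimension.
\<close>

lemma coframe_dual_frame:
  assumes e: "coframe e"
  obtains E where "\<forall>i\<in>{1..7}. \<forall>j\<in>{1..7}. e i (\<lambda>_. E j) = (if i = j then 1 else 0)"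
    and "\<forall>x. (\<forall>i\<in>{1..7}. e i (\<lambda>_. x) = 0) \<longrightarrow> x = 0"
proof -
  have alt: "alternating_form 1 (e i)" if "i \<in> {1..7}" for i
    using e that by (auto simp: coframe_def)
  obtain h :: "7 \<Rightarrow> nat" where h: "bij_betw h UNIV {1..7}"
    using finite_same_card_bij[of "UNIV :: 7 set" "{1..7::nat}"] by auto
  have hin: "h r \<in> {1..7}" for r using h by (auto simp: bij_betw_def)
  define L :: "real^7 \<Rightarrow> real^7" where "L x = (\<chi> r. e (h r) (\<lambda>_. x))" for x
  have lin: "linear L"
    by (rule linearI)
      (simp_all add: L_def vec_eq_iff linear_add[OF alternating_form_1_linear[OF alt[OF hin]]]
        linear_scale[OF alternating_form_1_linear[OF alt[OF hin]]])
  have "surj L"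
  proof (rule ccontr)
    assume "\<not> surj L"
    then have "span (range L) \<noteq> UNIV"
      using linear_subspace_image[OF lin subspace_UNIV] by (metis span_eq_iff)
    then obtain a where a: "a \<noteq> 0" "\<And>x. a \<bullet> L x = 0"
      using span_not_UNIV_orthogonal[of "range L"] span_base by (metis rangeI)
    define c where "c = (\<lambda>i. a $ inv_into UNIV h i)"
    have ch: "c (h r) = a $ r" for r
      using h by (simp add: c_def bij_betw_def)
    have "(\<Sum>i=1..7. c i * e i v) = 0" for v
    proof -
      have ei: "e i v = e i (\<lambda>_. v 0)" if "i \<in> {1..7}" for i
        by (rule alternating_form_1[OF alt[OF that]])
      have "(\<Sum>i=1..7. c i * e i v) = (\<Sum>i=1..7. c i * e i (\<lambda>_. v 0))"
        by (intro sum.cong refl) (use ei in auto)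
      also have "\<dots> = (\<Sum>r\<in>UNIV. c (h r) * e (h r) (\<lambda>_. v 0))"
        by (rule sum.reindex_bij_betw[OF h, symmetric])
      also have "\<dots> = a \<bullet> L (v 0)"
        by (simp add: ch L_def inner_vec_def)
      finally show ?thesis using a by simp
    qed
    then have "\<forall>i\<in>{1..7}. c i = 0" using e unfolding coframe_def by blast
    then have "a $ r = 0" for r using hin ch by metis
    then show False using a by (simp add: vec_eq_iff)
  qed
  then have "inj L" using linear_surjective_imp_injective[OF lin] by blast
  let ?g = "inv_into UNIV h"
  define E where "E j = inv L (axis (?g j) 1)" for j
  have LE: "L (E j) = axis (?g j) 1" for j
    unfolding E_def by (rule surj_f_inv_f[OF \<open>surj L\<close>])
  have hg: "h (?g i) = i" if "i \<in> {1..7}" for i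
    using bij_betw_inv_into_right[OF h that] .
  show thesis
  proof
    show "\<forall>i\<in>{1..7}. \<forall>j\<in>{1..7}. e i (\<lambda>_. E j) = (if i = j then 1 else 0)"
    proof (intro ballI)
      fix i j :: nat assume ij: "i \<in> {1..7}" "j \<in> {1..7}"
      have "e i (\<lambda>_. E j) = L (E j) $ ?g i" using hg[OF ij(1)] by (simp add: L_def)
      also have "\<dots> = (if ?g i = ?g j then 1 else 0)" by (simp add: LE axis_def)
      also have "?g i = ?g j \<longleftrightarrow> i = j" using hg ij by metis
      finally show "e i (\<lambda>_. E j) = (if i = j then 1 else 0)" .
    qed
  next
    show "\<forall>x. (\<forall>i\<in>{1..7}. e i (\<lambda>_. x) = 0) \<longrightarrow> x = 0"
    proof (intro allI impI)
      fix x assume "\<forall>i\<in>{1..7}. e i (\<lambda>_. x) = 0"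
      then have "L x = L 0" using hin linear_0[OF lin] by (simp add: L_def vec_eq_iff)
      then show "x = 0" using injD[OF \<open>inj L\<close>] by blast
    qed
  qed
qed

lemma g2_form_adapted_coframe:
  assumes "g2_form a"
  obtains e E where "\<forall>i. alternating_form 1 (e i)"
    and "\<forall>i\<in>{1..7}. \<forall>j\<in>{1..7}. e i (\<lambda>_. E j) = (if i = j then 1 else 0)"
    and "\<forall>x. (\<forall>i\<in>{1..7}. e i (\<lambda>_. x) = 0) \<longrightarrow> x = 0"
    and "a = const_form e phi"
proof -
  from assms obtain f where f: "coframe f" and a: "\<And>v. a v = e3 f 1 2 7 v + e3 f 3 4 7 v + e3 f 5 6 7 v
      + e3 f 1 3 5 v - e3 f 1 4 6 v - e3 f 2 3 6 v - e3 f 2 4 5 v"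
    unfolding g2_form_def by blast
  obtain E where E: "\<forall>i\<in>{1..7}. \<forall>j\<in>{1..7}. f i (\<lambda>_. E j) = (if i = j then 1 else 0)"
    "\<forall>x. (\<forall>i\<in>{1..7}. f i (\<lambda>_. x) = 0) \<longrightarrow> x = 0"
    by (rule coframe_dual_frame[OF f])
  \<comment> \<open>Setting the 1-forms with indices off \<open>1, \<dots>, 7\<close> to zero saves range conditions on indices.\<close>
  define e where "e i = (if i \<in> {1..7} then f i else (\<lambda>_. 0))" for i
  have alt: "alternating_form 1 (e i)" for i
  proof (cases "i \<in> {1..7}")
    case True
    then show ?thesis using f unfolding coframe_def e_def by simp
  next
    case False
    then have "e i = (\<lambda>_. 0)" unfolding e_def by (rule if_not_P)
    then show ?thesis by (simp add: alternating_form_def linear_zero)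
  qed
  have e3: "e3 f i j k = monomial e [i, j, k]" if "i \<in> {1..7}" "j \<in> {1..7}" "k \<in> {1..7}" for i j k
    using e3_eq_monomial[of e i j k, OF alt] that by (simp add: e3_def e_def)
  show thesis
  proof
    show "\<forall>i\<in>{1..7}. \<forall>j\<in>{1..7}. e i (\<lambda>_. E j) = (if i = j then 1 else 0)"
      using E(1) by (simp add: e_def)
    show "\<forall>x. (\<forall>i\<in>{1..7}. e i (\<lambda>_. x) = 0) \<longrightarrow> x = 0"
      using E(2) by (simp add: e_def)
    show "a = const_form e phi"
      by (simp add: fun_eq_iff a e3 phi_def const_form_Cons del: monomial.simps)
  qed (use alt in blast)
qed

text \<open>
  For every index \<open>p\<close> there is a monomial \<open>e\<^sup>j\<^sup>k\<^sup>l\<close> of \<open>\<phi>\<close> without \<open>e\<^sup>p\<close>. Two different index triples of \<open>\<phi>\<close>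
  have exactly one index in common (they are the lines of the Fano plane), so that
  \<open>\<eta> \<and> \<phi>\<close> takes the value \<open>\<plusminus> \<eta>(E\<^sub>p)\<close> at \<open>(E\<^sub>p, E\<^sub>j, E\<^sub>k, E\<^sub>l)\<close>.
\<close>

lemma g2_form_wedge_1_injective:
  assumes "g2_form a" and \<eta>: "alternating_form 1 \<eta>" and zero: "\<And>v. wedge 1 3 \<eta> a v = 0"
  shows "\<eta> (\<lambda>_. x) = 0"
proof -
  obtain e E where "\<forall>i. alternating_form 1 (e i)"
    and E: "\<forall>i\<in>{1..7}. \<forall>j\<in>{1..7}. e i (\<lambda>_. E j) = (if i = j then 1 else 0)"
    and nd: "\<forall>x. (\<forall>i\<in>{1..7}. e i (\<lambda>_. x) = 0) \<longrightarrow> x = 0"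
    and a: "a = const_form e phi"
    by (rule g2_form_adapted_coframe[OF assms(1)])
  then have e: "alternating_form 1 (e i)" for i by blast
  have alt: "alternating_form 3 a"
    unfolding a by (rule alternating_form_const_form[OF e]) (auto simp: phi_def)
  define A where "A u v w = a (case_nat u (case_nat v (\<lambda>_. w)))" for u v w
  have ev: "\<eta> (\<lambda>_. E p) * A (E j) (E k) (E l) - \<eta> (\<lambda>_. E j) * A (E p) (E k) (E l)
      + \<eta> (\<lambda>_. E k) * A (E p) (E j) (E l) - \<eta> (\<lambda>_. E l) * A (E p) (E j) (E k) = 0" for p j k l
  proof -
    define v where "v = case_nat (E p) (case_nat (E j) (case_nat (E k) (\<lambda>_. E l)))"
    have A3: "a w = A (w 0) (w 1) (w 2)" for w
      unfolding A_def by (rule alternating_form_cong[OF alt])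
        (auto simp: numeral_3_eq_3 numeral_2_eq_2 less_Suc_eq)
    have "wedge 1 3 \<eta> a v = (\<Sum>i\<le>3. (- 1) ^ i * (\<eta> (\<lambda>_. v i) * A (v (skip i 0)) (v (skip i 1)) (v (skip i 2))))"
      unfolding wedge_1_eq_alternation[OF \<eta> alt] alternation_def using A3 by simp
    then show ?thesis
      using zero[of v] by (simp add: numeral_3_eq_3 numeral_2_eq_2 skip_def v_def)
  qed
  have A: "A u v w = const_form e phi (case_nat u (case_nat v (\<lambda>_. w)))" for u v w
    by (simp add: A_def a)
  note eval = A phi_def const_form_Cons monomial_triple[OF e] E numeral_2_eq_2
  have "\<eta> (\<lambda>_. E p) = 0" if "p \<in> {1..7}" for p
  proof -
    have "\<eta> (\<lambda>_. E 1) = 0" using ev[of 1 3 4 7] by (simp add: eval del: monomial.simps)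
    moreover have "\<eta> (\<lambda>_. E 2) = 0" using ev[of 2 3 4 7] by (simp add: eval del: monomial.simps)
    moreover have "\<eta> (\<lambda>_. E 3) = 0" using ev[of 3 1 2 7] by (simp add: eval del: monomial.simps)
    moreover have "\<eta> (\<lambda>_. E 4) = 0" using ev[of 4 1 2 7] by (simp add: eval del: monomial.simps)
    moreover have "\<eta> (\<lambda>_. E 5) = 0" using ev[of 5 1 2 7] by (simp add: eval del: monomial.simps)
    moreover have "\<eta> (\<lambda>_. E 6) = 0" using ev[of 6 1 2 7] by (simp add: eval del: monomial.simps)
    moreover have "\<eta> (\<lambda>_. E 7) = 0" using ev[of 7 1 3 5] by (simp add: eval del: monomial.simps)
    moreover have "p \<in> {1, 2, 3, 4, 5, 6, 7}" using that by auto
    ultimately show ?thesis by auto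
  qed
  moreover have "x = (\<Sum>p=1..7. e p (\<lambda>_. x) *\<^sub>R E p)"
  proof -
    have "e i (\<lambda>_. x - (\<Sum>p=1..7. e p (\<lambda>_. x) *\<^sub>R E p)) = 0" if i: "i \<in> {1..7}" for i
    proof -
      note lin = alternating_form_1_linear[OF e[of i]]
      have "(\<Sum>p=1..7. e p (\<lambda>_. x) * e i (\<lambda>_. E p)) = (\<Sum>p=1..7. if p = i then e i (\<lambda>_. x) else 0)"
        by (intro sum.cong refl) (use E i in auto)
      then show ?thesis
        using i by (simp add: linear_diff[OF lin] linear_sum[OF lin] linear_scale[OF lin])
    qed
    then have "x - (\<Sum>p=1..7. e p (\<lambda>_. x) *\<^sub>R E p) = 0" using nd by blast
    then show ?thesis by simp
  qed
  ultimately show ?thesis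
    using linear_sum[OF alternating_form_1_linear[OF \<eta>], of "\<lambda>p. e p (\<lambda>_. x) *\<^sub>R E p" "{1..7}"]
    by (simp add: linear_scale[OF alternating_form_1_linear[OF \<eta>]])
qed

subsection \<open>The induced metric\<close>

lemma inner_product_coframe:
  assumes e: "\<And>i. alternating_form 1 (e i)"
    and nd: "\<forall>x. (\<forall>i\<in>I. e i (\<lambda>_. x) = 0) \<longrightarrow> x = 0" and I: "finite I"
  shows "inner_product (\<lambda>x y. \<Sum>i\<in>I. e i (\<lambda>_. x) * e i (\<lambda>_. y))"
  unfolding inner_product_def bilinear_def
proof (intro conjI allI impI)
  fix x y
  note lin = alternating_form_1_linear[OF e]
  show "linear (\<lambda>y. \<Sum>i\<in>I. e i (\<lambda>_. x) * e i (\<lambda>_. y))"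
    by (intro linear_compose_sum ballI linear_mult_const lin)
  show "linear (\<lambda>x. \<Sum>i\<in>I. e i (\<lambda>_. x) * e i (\<lambda>_. y))"
    by (intro linear_compose_sum ballI linear_const_mult lin)
  show "(\<Sum>i\<in>I. e i (\<lambda>_. x) * e i (\<lambda>_. y)) = (\<Sum>i\<in>I. e i (\<lambda>_. y) * e i (\<lambda>_. x))"
    by (simp add: mult.commute)
  assume "x \<noteq> 0"
  then obtain i where "i \<in> I" "e i (\<lambda>_. x) \<noteq> 0" using nd by blast
  then show "0 < (\<Sum>i\<in>I. e i (\<lambda>_. x) * e i (\<lambda>_. x))"
    using I by (intro sum_pos2[of I i]) (auto simp: zero_less_mult_iff linorder_neq_iff)
qed

text \<open>
  The coordinates of an orthonormal frame with respect to the coframe are an orthogonal matrix,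
  whose determinant is \<open>\<plusminus> 1\<close>.
\<close>

lemma volume_form_coframe:
  fixes e :: "nat \<Rightarrow> (real^7) covec"
  assumes e: "\<And>i. alternating_form 1 (e i)"
  shows "volume_form (\<lambda>x y. \<Sum>i=1..7. e i (\<lambda>_. x) * e i (\<lambda>_. y)) (monomial e [1, 2, 3, 4, 5, 6, 7])"
  unfolding volume_form_def
proof (intro conjI allI impI)
  let ?is = "[1, 2, 3, 4, 5, 6, 7 :: nat]"
  have len: "length ?is = 7" by simp
  show "alternating_form 7 (monomial e ?is)"
    using alternating_form_monomial[of e ?is, OF e] unfolding len .
  fix v :: "nat \<Rightarrow> real^7"
  assume on: "\<forall>i<7. \<forall>j<7. (\<Sum>m=1..7. e m (\<lambda>_. v i) * e m (\<lambda>_. v j)) = (if i = j then 1 else 0)"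
  obtain h :: "7 \<Rightarrow> nat" where h: "bij_betw h UNIV {..<7}"
    using finite_same_card_bij[of "UNIV :: 7 set" "{..<7::nat}"] by auto
  have h7: "h r < 7" and hinj: "inj h" for r using h by (auto simp: bij_betw_def)
  define Q :: "real^7^7" where "Q = (\<chi> r s. e (?is ! h r) (\<lambda>_. v (h s)))"
  have "(transpose Q ** Q) $ r $ s = mat 1 $ r $ s" for r s
  proof -
    have nth: "?is ! m = Suc m" if "m < 7" for m
      using that by (auto simp: less_Suc_eq numeral_eq_Suc)
    have "(transpose Q ** Q) $ r $ s = (\<Sum>t\<in>UNIV. e (?is ! h t) (\<lambda>_. v (h r)) * e (?is ! h t) (\<lambda>_. v (h s)))"
      by (simp add: matrix_matrix_mult_def transpose_def Q_def)
    also have "\<dots> = (\<Sum>m<7. e (?is ! m) (\<lambda>_. v (h r)) * e (?is ! m) (\<lambda>_. v (h s)))"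
      by (rule sum.reindex_bij_betw[OF h])
    also have "\<dots> = (\<Sum>m<7. e (Suc m) (\<lambda>_. v (h r)) * e (Suc m) (\<lambda>_. v (h s)))"
      by (intro sum.cong refl) (simp only: lessThan_iff nth)
    also have "\<dots> = (\<Sum>m=1..7. e m (\<lambda>_. v (h r)) * e m (\<lambda>_. v (h s)))"
      by (rule sum.reindex_bij_witness[of _ "\<lambda>m. m - 1" Suc]) auto
    also have "\<dots> = mat 1 $ r $ s"
      using on h7 injD[OF hinj] by (auto simp: mat_def)
    finally show ?thesis .
  qed
  then have "orthogonal_matrix Q"
    unfolding orthogonal_matrix by (simp only: vec_eq_iff) blast
  moreover have "monomial e ?is v = det Q"
    unfolding Q_def by (rule monomial_eq_det[OF e]) (simp only: len h)
  ultimately show "\<bar>monomial e ?is v\<bar> = 1"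
    using det_orthogonal_matrix[of Q] by auto
qed

text \<open>
  The coefficients \<open>6 \<delta>\<^sub>p\<^sub>q\<close> of \<open>i\<^sub>x \<phi> \<and> i\<^sub>y \<phi> \<and> \<phi>\<close> come from the computation with monomials.
\<close>

lemma g2_form_top_form:
  fixes e :: "nat \<Rightarrow> 'v::real_vector covec"
  assumes e: "\<And>i. alternating_form 1 (e i)"
  shows "wedge 2 5 (contract x (const_form e phi)) (wedge 2 3 (contract y (const_form e phi)) (const_form e phi)) v
    = 6 * (\<Sum>p=1..7. e p (\<lambda>_. x) * e p (\<lambda>_. y)) * monomial e [1, 2, 3, 4, 5, 6, 7] v"
proof -
  let ?top = "monomial e [1, 2, 3, 4, 5, 6, 7] v"
  have phi3: "length is = 3" if "(c, is) \<in> set phi" for c "is"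
    using that by (auto simp: phi_def)
  have phi2: "length is = 2" if "(c, is) \<in> set (contract_phi p)" for c "is" p
    using that by (auto simp: phi_def contract_phi_def split: if_splits)
  have len5: "length is = 5" if "(c, is) \<in> set (ext_mult (contract_phi q) phi)" for c "is" q
    using that phi2 phi3 by (fastforce simp: ext_mult_def)
  have W: "wedge 2 5 (const_form e (contract_phi p)) (wedge 2 3 (const_form e (contract_phi q)) (const_form e phi)) v
      = (if p = q then 6 else 0) * ?top" if "p \<in> {1..7}" "q \<in> {1..7}" for p q
  proof -
    have "{1..7} = set [1, 2, 3, 4, 5, 6, 7::nat]" by auto
    then have "is_top (if p = q then 6 else 0) (ext_mult (contract_phi p) (ext_mult (contract_phi q) phi))"
      using g2_top_form that unfolding list_all_iff by blast
    from const_form_top[OF e this, where v = v] show ?thesis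
      by (simp add: wedge_2_const_form[OF e phi2 phi3] wedge_2_const_form[OF e phi2 len5] del: monomial.simps)
  qed
  have "wedge 2 5 (contract x (const_form e phi)) (wedge 2 3 (contract y (const_form e phi)) (const_form e phi)) v
      = (\<Sum>p=1..7. e p (\<lambda>_. x) * (\<Sum>q=1..7. e q (\<lambda>_. y) *
          wedge 2 5 (const_form e (contract_phi p)) (wedge 2 3 (const_form e (contract_phi q)) (const_form e phi)) v))"
    unfolding contract_const_form_phi[OF e] wedge_sum_left wedge_sum_right ..
  also have "\<dots> = (\<Sum>p=1..7. e p (\<lambda>_. x) * (\<Sum>q=1..7. if q = p then e q (\<lambda>_. y) * (6 * ?top) else 0))"
    using W by (intro sum.cong refl arg_cong2[where f = "(*)"]) (simp del: monomial.simps)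
  also have "\<dots> = 6 * (\<Sum>p=1..7. e p (\<lambda>_. x) * e p (\<lambda>_. y)) * ?top"
    by (simp add: sum_distrib_left sum_distrib_right mult_ac del: monomial.simps)
  finally show ?thesis .
qed

text \<open>
  Two solutions \<open>g, g'\<close> of the defining identity are proportional, because both \<open>g dV\<close> and \<open>g' dV'\<close>
  are the given 7-form. Rescaling an orthonormal frame shows that \<open>g' = c g\<close> leads to
  \<open>dV' = c\<^bsup>7/2\<^esup> dV\<close> up to sign, so \<open>c\<^bsup>9/2\<^esup> = 1\<close>.
\<close>

lemma g2_metric_coframe:
  fixes e :: "nat \<Rightarrow> (real^7) covec"
  assumes e: "\<And>i. alternating_form 1 (e i)"
    and E: "\<forall>i\<in>{1..7}. \<forall>j\<in>{1..7}. e i (\<lambda>_. E j) = (if i = j then 1 else 0)"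
    and nd: "\<forall>x. (\<forall>i\<in>{1..7}. e i (\<lambda>_. x) = 0) \<longrightarrow> x = 0"
  shows "g2_metric (const_form e phi) = (\<lambda>x y. \<Sum>i=1..7. e i (\<lambda>_. x) * e i (\<lambda>_. y))" (is "_ = ?G")
  unfolding g2_metric_def
proof (rule the_equality, intro conjI exI allI)
  let ?dV = "monomial e [1, 2, 3, 4, 5, 6, 7]"
  have B: "1/6 * wedge 2 5 (contract x (const_form e phi)) (wedge 2 3 (contract y (const_form e phi)) (const_form e phi)) v
      = ?G x y * ?dV v" for x y v
    unfolding g2_form_top_form[OF e] by simp
  show "inner_product ?G" by (rule inner_product_coframe[OF e nd]) auto
  show vol: "volume_form ?G ?dV" by (rule volume_form_coframe[OF e])
  show "?G x y * ?dV v = 1/6 * wedge 2 5 (contract x (const_form e phi)) (wedge 2 3 (contract y (const_form e phi)) (const_form e phi)) v"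
    for x y v by (rule B[symmetric])
  fix g assume "inner_product g \<and> (\<exists>dV. volume_form g dV \<and> (\<forall>x y v. g x y * dV v =
    1/6 * wedge 2 5 (contract x (const_form e phi)) (wedge 2 3 (contract y (const_form e phi)) (const_form e phi)) v))"
  then obtain dV where g: "inner_product g" and dV: "volume_form g dV"
    and eq: "\<And>x y v. g x y * dV v = ?G x y * ?dV v"
    unfolding B by blast
  define v where "v = (\<lambda>i. E (Suc i))"
  have GE: "?G (E i) (E j) = (if i = j then 1 else 0)" if "i \<in> {1..7}" "j \<in> {1..7}" for i j
  proof -
    have "?G (E i) (E j) = (\<Sum>m=1..7. if m = i then (if i = j then 1 else 0) else 0)"
      by (intro sum.cong refl) (use E that in auto)
    then show ?thesis using that by simp
  qed
  have Gv: "?G (v i) (v j) = (if i = j then 1 else 0)" if "i < 7" "j < 7" for i j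
    using GE[of "Suc i" "Suc j"] that by (simp add: v_def)
  define s where "s = ?dV v"
  define t where "t = dV v"
  have s: "\<bar>s\<bar> = 1" using vol Gv by (auto simp: volume_form_def s_def simp del: monomial.simps)
  have gst: "g x y * t = ?G x y * s" for x y
    using eq[of x y v] by (simp only: s_def t_def)
  have t0: "t \<noteq> 0" using gst[of "v 0" "v 0"] Gv[of 0 0] s by auto
  define c where "c = s / t"
  have gc: "g x y = c * ?G x y" for x y
    using gst[of x y] t0 by (simp add: c_def field_simps)
  have v0: "v 0 \<noteq> 0"
    using Gv[of 0 0] linear_0[OF alternating_form_1_linear[OF e]] by auto
  have "0 < g (v 0) (v 0)" using g v0 unfolding inner_product_def by blast
  then have c: "c > 0" using gc[of "v 0" "v 0"] Gv[of 0 0] by simp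
  define r where "r = 1 / sqrt c"
  have r: "r > 0" "r * r = 1 / c" using c by (auto simp: r_def)
  have "g (r *\<^sub>R x) (r *\<^sub>R y) = ?G x y" for x y
  proof -
    have "g (r *\<^sub>R x) (r *\<^sub>R y) = r * r * g x y"
      using g bilinear_lmul[of g r x "r *\<^sub>R y"] bilinear_rmul[of g x r y]
      by (simp add: inner_product_def)
    then show ?thesis using r c gc[of x y] by simp
  qed
  then have "\<bar>dV (\<lambda>i. r *\<^sub>R v i)\<bar> = 1"
    using dV Gv by (simp add: volume_form_def)
  moreover have "dV (\<lambda>i. r *\<^sub>R v i) = r ^ 7 * t"
    using alternating_form_scale[of 7 dV r v] dV by (simp add: volume_form_def t_def)
  ultimately have rt: "r ^ 7 * \<bar>t\<bar> = 1" using r by (simp add: abs_mult)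
  have "c = 1 / \<bar>t\<bar>" using abs_divide[of s t] c by (simp only: s abs_of_pos flip: c_def)
  then have "\<bar>t\<bar> = r * r" using r by simp
  then have "r ^ 9 = 1" using rt by (simp add: numeral_eq_Suc mult_ac)
  then have "r = 1" using r power_eq_iff_eq_base[of 9 r 1] by simp
  then have "c = 1" using r c by simp
  then show "g = ?G" using gc by (simp add: fun_eq_iff)
qed

lemma inner_product_g2_metric:
  assumes "g2_form a"
  shows "inner_product (g2_metric a)"
proof -
  obtain e E where "\<forall>i. alternating_form 1 (e i)"
    and E: "\<forall>i\<in>{1..7}. \<forall>j\<in>{1..7}. e i (\<lambda>_. E j) = (if i = j then 1 else 0)"
    and nd: "\<forall>x. (\<forall>i\<in>{1..7}. e i (\<lambda>_. x) = 0) \<longrightarrow> x = 0"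
    and a: "a = const_form e phi"
    by (rule g2_form_adapted_coframe[OF assms])
  then have e: "alternating_form 1 (e i)" for i by blast
  show ?thesis
    unfolding a g2_metric_coframe[OF e E nd] by (rule inner_product_coframe[OF e nd]) auto
qed

section \<open>Functions with vanishing derivative on a connected manifold\<close>

text \<open>
  A function with vanishing derivative is constant on balls in each chart. The sets where it takes
  the value \<open>c\<close>, and where it takes another value, are therefore both open.
\<close>

lemma locally_constant_on_manifold:
  fixes F :: "'a chart \<Rightarrow> real^7 \<Rightarrow> real"
  assumes atlas: "smooth_atlas M A" and conn: "connected_space M"
    and glue: "\<And>C C' p. C \<in> A \<Longrightarrow> C' \<in> A \<Longrightarrow> p \<in> fst C \<inter> fst C' \<Longrightarrow> F C (snd C p) = F C' (snd C' p)"
    and deriv: "\<And>C x. C \<in> A \<Longrightarrow> x \<in> chart_image C \<Longrightarrow> (F C has_derivative (\<lambda>u. 0)) (at x)"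
  shows "\<exists>c. \<forall>C\<in>A. \<forall>x\<in>chart_image C. F C x = c"
proof (cases "\<exists>C\<in>A. chart_image C \<noteq> {}")
  case True
  define U where "U V = {p \<in> topspace M. \<exists>C\<in>A. p \<in> fst C \<and> F C (snd C p) \<in> V}" for V
  have chart: "is_chart M C" if "C \<in> A" for C
    using atlas that by (auto simp: smooth_atlas_def)
  have cover: "(\<Union>C\<in>A. fst C) = topspace M"
    using atlas by (auto simp: smooth_atlas_def)
  have U_open: "openin M (U V)" for V
  proof (subst openin_subopen, intro ballI)
    fix p assume "p \<in> U V"
    then obtain C where C: "C \<in> A" "p \<in> fst C" "F C (snd C p) \<in> V" by (auto simp: U_def)
    let ?S = "chart_image C"
    have S: "open ?S" "snd C p \<in> ?S" "openin M (fst C)"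
      and hom: "homeomorphic_map (subtopology M (fst C)) (top_of_set ?S) (snd C)"
      using chart[OF C(1)] C(2) by (auto simp: is_chart_def chart_image_def)
    from S(1,2) obtain r where r: "r > 0" "ball (snd C p) r \<subseteq> ?S"
      by (rule openE)
    have "(F C has_derivative (\<lambda>u. 0)) (at y within ball (snd C p) r)" if "y \<in> ball (snd C p) r" for y
      using has_derivative_at_withinI[OF deriv[OF C(1) subsetD[OF r(2) that]]] .
    from has_derivative_zero_constant[OF convex_ball this]
    obtain k where "\<forall>y\<in>ball (snd C p) r. F C y = k" by metis
    then have const: "F C y = F C (snd C p)" if "y \<in> ball (snd C p) r" for y
      using that r by simp
    let ?T = "{q \<in> topspace (subtopology M (fst C)). snd C q \<in> ball (snd C p) r}"
    have "openin (top_of_set ?S) (ball (snd C p) r)"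
      using r(2) S(1) by (simp add: openin_open_eq)
    then have "openin (subtopology M (fst C)) ?T"
      by (rule openin_continuous_map_preimage[OF homeomorphic_imp_continuous_map[OF hom]])
    then have "openin M ?T"
      using S(3) openin_trans_full by blast
    moreover have "p \<in> ?T" using C r openin_subset[OF S(3)] by auto
    moreover have "?T \<subseteq> U V"
      using C const by (auto simp: U_def)
    ultimately show "\<exists>T. openin M T \<and> p \<in> T \<and> T \<subseteq> U V" by blast
  qed
  obtain C0 p0 where C0: "C0 \<in> A" "p0 \<in> fst C0"
    using True by (auto simp: chart_image_def)
  define c where "c = F C0 (snd C0 p0)"
  have p0: "p0 \<in> U {c}" using C0 cover by (auto simp: U_def c_def)
  have "topspace M \<subseteq> U {c} \<union> U (- {c})" using cover by (auto simp: U_def)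
  moreover have "U {c} \<inter> U (- {c}) = {}"
  proof (rule ccontr)
    assume "U {c} \<inter> U (- {c}) \<noteq> {}"
    then obtain p C C' where "C \<in> A" "p \<in> fst C" "F C (snd C p) = c"
        "C' \<in> A" "p \<in> fst C'" "F C' (snd C' p) \<noteq> c"
      unfolding U_def by blast
    then show False using glue[of C C' p] by simp
  qed
  ultimately have empty: "U (- {c}) = {}"
    using conn U_open p0 unfolding connected_space_def by blast
  have "F C x = c" if "C \<in> A" "x \<in> chart_image C" for C x
  proof -
    obtain p where "p \<in> fst C" "x = snd C p" using \<open>x \<in> chart_image C\<close> by (auto simp: chart_image_def)
    then show ?thesis using empty cover \<open>C \<in> A\<close> by (auto simp: U_def)
  qed
  then show ?thesis by (intro exI[of _ c] ballI)
qed simp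

section \<open>Lie derivative of the structure along the dual of the Lee form\<close>

text \<open>
  With \<open>f = \<theta>(X)\<close>: if \<open>f \<phi> = d\<^sub>\<theta> \<omega>\<close> near a point, then
  \<open>0 = d\<^sub>\<theta> (f \<phi>) = df \<and> \<phi> + f d\<^sub>\<theta> \<phi> = df \<and> \<phi>\<close> there, and a
  1-form whose product with \<open>\<phi>\<close> vanishes is zero.
\<close>

lemma dir_deriv_pairing_eq_0:
  fixes X :: "'a vfield" and \<phi> \<theta> :: "'a dform"
  assumes S: "open S" "x \<in> S"
    and alt\<phi>: "\<And>y. y \<in> S \<Longrightarrow> alternating_form 3 (\<phi> C y)"
    and \<phi>: "\<And>v. smooth_on S (\<lambda>y. \<phi> C y v)"
    and alt\<theta>: "\<And>y. y \<in> S \<Longrightarrow> alternating_form 1 (\<theta> C y)"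
    and \<theta>: "\<And>v. smooth_on S (\<lambda>y. \<theta> C y v)"
    and X: "smooth_on S (X C)"
    and closed: "\<And>v. ext_deriv 1 \<theta> C x v = 0"
    and lcc: "\<And>v. twisted_deriv 3 \<theta> \<phi> C x v = 0"
    and g2: "g2_form (\<phi> C x)"
    and eq: "\<And>y v. y \<in> S \<Longrightarrow> pairing \<theta> X C y * \<phi> C y v = twisted_deriv 2 \<theta> (form_contract X \<phi>) C y v"
  shows "(pairing \<theta> X C has_derivative (\<lambda>u. 0)) (at x)"
proof -
  let ?f = "pairing \<theta> X C"
  have alt\<omega>: "alternating_form 2 (form_contract X \<phi> C y)" if "y \<in> S" for y
    unfolding form_contract_def
    by (rule alternating_form_contract) (use alt\<phi>[OF that] in \<open>simp add: numeral_3_eq_3 numeral_2_eq_2\<close>)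
  have \<omega>: "Ck_on 2 S (\<lambda>y. form_contract X \<phi> C y w)" for w
    unfolding form_contract_def
    using alt\<phi>
    by (intro Ck_on_contract[OF S(1), where k = 2] smooth_on_imp_Ck_on[OF \<phi>] smooth_on_imp_Ck_on[OF X]) simp
  have "Ck_on 1 S (\<lambda>y. contract (X C y) (\<theta> C y) (\<lambda>_. 0))"
    using alt\<theta>
    by (intro Ck_on_contract[OF S(1), where k = 0] smooth_on_imp_Ck_on[OF \<theta>] smooth_on_imp_Ck_on[OF X]) simp
  moreover have "contract (X C y) (\<theta> C y) (\<lambda>_. 0) = ?f y" if "y \<in> S" for y
    using alternating_form_1[OF alt\<theta>[OF that], of "case_nat (X C y) (\<lambda>_. 0)"]
    by (simp add: contract_def pairing_def)
  ultimately have "Ck_on 1 S ?f" by (rule Ck_on_cong[OF S(1), rotated])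
  then have f: "?f differentiable (at x)" using S by simp
  have d\<phi>: "(\<lambda>y. \<phi> C y w) differentiable (at x)" for w
    using smooth_on_differentiable[OF \<phi> S(2)] .
  have d\<theta>: "(\<lambda>y. \<theta> C y w) differentiable (at x)" for w
    using smooth_on_differentiable[OF \<theta> S(2)] .
  let ?\<eta> = "\<lambda>v. dir_deriv ?f x (v 0)"
  have lin: "linear (dir_deriv ?f x)"
    using linear_frechet_derivative[OF f] .
  have \<eta>: "alternating_form 1 ?\<eta>"
    using lin by (auto simp: alternating_form_def)
  have "wedge 1 3 ?\<eta> (\<phi> C x) v = 0" for v
  proof -
    have "0 = alternation 3 (\<lambda>u w. dir_deriv (\<lambda>y. ?f y * \<phi> C y w) x u
        + \<theta> C x (\<lambda>_. u) * (?f x * \<phi> C x w)) v"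
      using twisted_deriv_twisted_deriv[where k = 2 and C = C and \<theta> = \<theta> and \<alpha> = "form_contract X \<phi>"
          and \<beta> = "\<lambda>y w. ?f y * \<phi> C y w", OF S alt\<theta> d\<theta> closed alt\<omega> \<omega> eq]
      by simp
    also have "\<dots> = alternation 3 (\<lambda>u w. dir_deriv ?f x u * \<phi> C x w
        + ?f x * (dir_deriv (\<lambda>y. \<phi> C y w) x u + \<theta> C x (\<lambda>_. u) * \<phi> C x w)) v"
      unfolding dir_deriv_mult[OF f d\<phi>] by (simp add: algebra_simps)
    also have "\<dots> = wedge 1 3 ?\<eta> (\<phi> C x) v + ?f x * twisted_deriv 3 \<theta> \<phi> C x v"
      unfolding wedge_1_eq_alternation[OF \<eta> alt\<phi>[OF S(2)]]
        twisted_deriv_eq_alternation[of \<theta> C x 3 \<phi>, OF alt\<theta>[OF S(2)] alt\<phi>[OF S(2)]]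
        alternation_add alternation_mult ..
    finally show ?thesis by (simp add: lcc)
  qed
  then have "dir_deriv ?f x u = 0" for u
    using g2_form_wedge_1_injective[OF g2 \<eta>] by blast
  then show ?thesis using f frechet_derivative_works by (metis (no_types, lifting) ext)
qed

theorem proposition4p4:
  fixes M :: "'a topology" and A :: "'a chart set"
    and \<phi> \<theta> \<omega> :: "'a dform" and X :: "'a vfield"
  assumes "smooth_manifold M A" and "connected_space M"
    and "lcc_g2_structure A \<phi> \<theta>"
    and "vector_field A X" and "metric_dual A \<phi> \<theta> X"
    and "\<omega> = form_contract X \<phi>"
  shows "(form_eq A (lie_deriv 3 X \<phi>) (\<lambda>C x v. 0) \<longleftrightarrow>
          form_eq A (\<lambda>C x v. pairing \<theta> X C x * \<phi> C x v) (twisted_deriv 2 \<theta> \<omega>)) \<and>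
         (form_eq A (lie_deriv 3 X \<phi>) (\<lambda>C x v. 0) \<longrightarrow>
          (\<exists>c. c \<noteq> 0 \<and> (\<forall>C\<in>A. \<forall>x\<in>chart_image C.
             pairing \<theta> X C x = (g2_norm (\<phi> C x) (X C x))\<^sup>2 \<and> pairing \<theta> X C x = c)))"
proof -
  have atlas: "smooth_atlas M A" using assms(1) by (simp add: smooth_manifold_def)
  have S: "open (chart_image C)" if "C \<in> A" for C
    using atlas that by (auto simp: smooth_atlas_def is_chart_def)
  have \<phi>form: "differential_form A 3 \<phi>" and \<theta>form: "differential_form A 1 \<theta>"
    using assms(3) by (auto simp: lcc_g2_structure_def g2_structure_def)
  have alt\<phi>: "alternating_form 3 (\<phi> C x)" and alt\<theta>: "alternating_form 1 (\<theta> C x)"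
    and g2: "g2_form (\<phi> C x)" and nz: "\<exists>v. \<theta> C x v \<noteq> 0"
    and closed: "ext_deriv 1 \<theta> C x v = 0"
    and lcc: "ext_deriv 3 \<phi> C x v = - wedge 1 3 (\<theta> C x) (\<phi> C x) v"
    if "C \<in> A" "x \<in> chart_image C" for C x v
    using assms(3) that
    by (simp_all add: lcc_g2_structure_def g2_structure_def differential_form_def form_eq_def form_wedge_def)
  have sm\<phi>: "smooth_on (chart_image C) (\<lambda>x. \<phi> C x v)" and sm\<theta>: "smooth_on (chart_image C) (\<lambda>x. \<theta> C x v)"
    and smX: "smooth_on (chart_image C) (X C)" if "C \<in> A" for C v
    using \<phi>form \<theta>form assms(4) that by (simp_all add: differential_form_def vector_field_def)

  \<comment> \<open>Cartan's formula with \<open>d\<phi> = - \<theta> \<and> \<phi>\<close>; contraction is an antiderivation.\<close>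
  have lie: "lie_deriv 3 X \<phi> C x v = twisted_deriv 2 \<theta> \<omega> C x v - pairing \<theta> X C x * \<phi> C x v"
    if C: "C \<in> A" "x \<in> chart_image C" for C x v
  proof -
    have 3: "3 = Suc 2" by simp
    have "lie_deriv 3 X \<phi> C x v
        = ext_deriv 2 \<omega> C x v + contract (X C x) (ext_deriv 3 \<phi> C x) v"
      unfolding 3 assms(6)
      by (rule lie_deriv_Cartan[OF S[OF C(1)] C(2)])
        (use alt\<phi> C smooth_on_differentiable[OF sm\<phi>] smooth_on_differentiable[OF smX] in auto)
    also have "contract (X C x) (ext_deriv 3 \<phi> C x) v
        = - contract (X C x) (wedge 1 3 (\<theta> C x) (\<phi> C x)) v"
      by (simp only: contract_def lcc[OF C])
    also have "contract (X C x) (wedge 1 3 (\<theta> C x) (\<phi> C x)) v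
        = pairing \<theta> X C x * \<phi> C x v - form_wedge 1 2 \<theta> \<omega> C x v"
      using contract_wedge_1[OF alt\<theta>[OF C], of 2 "\<phi> C x"] alt\<phi>[OF C]
      by (simp add: pairing_def form_wedge_def form_contract_def assms(6))
    finally show ?thesis by (simp add: twisted_deriv_def)
  qed
  have equiv: "form_eq A (lie_deriv 3 X \<phi>) (\<lambda>C x v. 0) \<longleftrightarrow>
      form_eq A (\<lambda>C x v. pairing \<theta> X C x * \<phi> C x v) (twisted_deriv 2 \<theta> \<omega>)"
    unfolding form_eq_def
  proof (intro ball_cong refl all_cong1)
    fix C x v assume "C \<in> A" "x \<in> chart_image C"
    from lie[OF this, of v] show "lie_deriv 3 X \<phi> C x v = 0 \<longleftrightarrow>
        pairing \<theta> X C x * \<phi> C x v = twisted_deriv 2 \<theta> \<omega> C x v"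
      by linarith
  qed

  have norm: "pairing \<theta> X C x = (g2_norm (\<phi> C x) (X C x))\<^sup>2" and pos: "pairing \<theta> X C x > 0"
    if C: "C \<in> A" "x \<in> chart_image C" for C x
  proof -
    have ip: "inner_product (g2_metric (\<phi> C x))" by (rule inner_product_g2_metric[OF g2[OF C]])
    have dual: "\<theta> C x (\<lambda>_. u) = g2_metric (\<phi> C x) (X C x) u" for u
      using assms(5) C by (simp add: metric_dual_def)
    have "X C x \<noteq> 0"
    proof
      assume "X C x = 0"
      then have "\<theta> C x (\<lambda>_. u) = 0" for u
        using ip bilinear_lzero dual unfolding inner_product_def by metis
      then show False using nz[OF C] alternating_form_1[OF alt\<theta>[OF C]] by metis
    qed
    then have "g2_metric (\<phi> C x) (X C x) (X C x) > 0"
      using ip unfolding inner_product_def by blast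
    then show "pairing \<theta> X C x = (g2_norm (\<phi> C x) (X C x))\<^sup>2" "pairing \<theta> X C x > 0"
      by (simp_all add: pairing_def dual g2_norm_def)
  qed

  have "\<exists>c. c \<noteq> 0 \<and> (\<forall>C\<in>A. \<forall>x\<in>chart_image C.
      pairing \<theta> X C x = (g2_norm (\<phi> C x) (X C x))\<^sup>2 \<and> pairing \<theta> X C x = c)"
    if "form_eq A (lie_deriv 3 X \<phi>) (\<lambda>C x v. 0)"
  proof -
    have eq: "pairing \<theta> X C x * \<phi> C x v = twisted_deriv 2 \<theta> (form_contract X \<phi>) C x v"
      if "C \<in> A" "x \<in> chart_image C" for C x v
      using \<open>form_eq A _ _\<close> equiv that assms(6) by (simp add: form_eq_def)
    have twist: "twisted_deriv 3 \<theta> \<phi> C x v = 0" if "C \<in> A" "x \<in> chart_image C" for C x v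
      using lcc[OF that] by (simp add: twisted_deriv_def form_wedge_def)
    have "\<exists>c. \<forall>C\<in>A. \<forall>x\<in>chart_image C. pairing \<theta> X C x = c"
    proof (rule locally_constant_on_manifold[OF atlas assms(2)])
      fix C C' p assume p: "C \<in> A" "C' \<in> A" "p \<in> fst C \<inter> fst C'"
      have "X C' (snd C' p) = dir_deriv (transition C C') (snd C p) (X C (snd C p))"
        using assms(4) p unfolding vector_field_def by blast
      moreover have "\<theta> C (snd C p) v = \<theta> C' (snd C' p) (\<lambda>i. dir_deriv (transition C C') (snd C p) (v i))" for v
        using \<theta>form p unfolding differential_form_def by blast
      ultimately show "pairing \<theta> X C (snd C p) = pairing \<theta> X C' (snd C' p)"
        by (simp only: pairing_def)
    next
      fix C x assume C: "C \<in> A" "x \<in> chart_image C"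
      show "(pairing \<theta> X C has_derivative (\<lambda>u. 0)) (at x)"
        by (rule dir_deriv_pairing_eq_0[where \<phi> = \<phi>, OF S[OF C(1)] C(2) alt\<phi>[OF C(1)] sm\<phi>[OF C(1)]
              alt\<theta>[OF C(1)] sm\<theta>[OF C(1)] smX[OF C(1)] closed[OF C] twist[OF C] g2[OF C] eq[OF C(1)]])
    qed
    then obtain c where c: "\<forall>C\<in>A. \<forall>x\<in>chart_image C. pairing \<theta> X C x = c" by blast
    \<comment> \<open>The constant is arbitrary, and has to be chosen nonzero, if \<open>M\<close> is empty.\<close>
    show ?thesis
    proof (cases "\<exists>C\<in>A. chart_image C \<noteq> {}")
      case True
      then have "c \<noteq> 0" using c pos by (metis ex_in_conv less_irrefl)
      then show ?thesis using c norm by metis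
    next
      case False
      then show ?thesis by (intro exI[of _ 1]) auto
    qed
  qed
  with equiv show ?thesis by blast
qed

end
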